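(* Let $f:\mathbb{R}^n\times\mathbb{R}^m\to\mathbb{R}^n$ and $g:\mathbb{R}^n\times\mathbb{R}^m\to\mathbb{R}^{n\times l}$ be smooth with $f(0,0)=0$, $g(0,0)=0$. Let $k:\mathbb{R}^l\times\mathbb{R}^n\to\mathbb{R}^m$ be smooth with $k(\theta,0)=0$ for all $\theta\in\mathbb{R}^l$. Let $V_\theta,Q_\theta:\mathbb{R}^n\to\mathbb{R}_+$ ($\theta\in\mathbb{R}^l$) be two families of continuous, positive definite and radially unbounded functions such that the mappings $(\theta,x)\mapsto V_\theta(x)$ and $(\theta,x)\mapsto Q_\theta(x)$ are continuous on $\mathbb{R}^l\times\mathbb{R}^n$. Assume: (i) For each $\theta\in\mathbb{R}^l$, $0\in\mathbb{R}^n$ is globally asymptotically stable for $$\dot x=f(x,k(\theta,x))+g(x,k(\theta,x))\theta.\qquad( * )$$ Moreover, for every $\theta\in\mathbb{R}^l$, $x_0\in\mathbb{R}^n$ the solution $x(t)$ of $( * )$ with $x(0)=x_0$ satisfies $V_\theta(x(t))\le Q_\theta(x_0)$ for all $t\ge 0$. (ii) For every non-empty compact set $\Theta\subset\mathbb{R}^l$ and every $M\ge 0$ there exists $R>0$ such that $V_\theta(x)\le M$, $\theta\in\Theta$ imply $|x|\le R$. (iii) $N$ is a positive integer for which the following implication holds: if there exist times $0=\tau_0<\tau_1<\dots<\tau_N$, vectors $\theta,d_0,\dots,d_N\in\mathbb{R}^l$ with $d_i\neq 0$ for $i=0,\dots,N$, and a right differentiable mapping $x\in C^0([0,\tau_N];\mathbb{R}^n)\cap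 C^1([0,\tau_N]\setminus\{\tau_0,\dots,\tau_N\};\mathbb{R}^n)$ satisfying $\dot x(t)=f(x(t),k(\theta+d_i,x(t)))+g(x(t),k(\theta+d_i,x(t)))\theta$ for $t\in[\tau_i,\tau_{i+1})$, $i=0,\dots,N-1$, and $g(x(t),k(\theta+d_j,x(t)))\,d_{i+1}=0$ for all $t\in[\tau_j,\tau_{j+1}]$, $i=0,\dots,N-1$, $j=0,\dots,i$, then $x(t)=0$ for all $t\in[0,\tau_N]$. (iv) For each $\theta\in\mathbb{R}^l$ there exist constants $M_\theta,\omega_\theta,R_\theta>0$ such that for every $x_0\in\mathbb{R}^n$ with $|x_0|\le R_\theta$ the solution of $( * )$ with $x(0)=x_0$ satisfies $|x(t)|\le M_\theta\exp(-\omega_\theta t)|x_0|$ for all $t\ge0$. (v) For every non-empty compact set $\Theta\subset\mathbb{R}^l$ there exist constants $R>0$, $K_2>K_1>0$ such that $K_1|x|^2\le V_\theta(x)\le Q_\theta(x)\le K_2|x|^2$ for all $x\in\mathbb{R}^n$, $\theta\in\Theta$ with $|x|\le R$. Let $T>0$, let $a:\mathbb{R}^n\to\mathbb{R}_+$ be a continuous, positive definite function with $\sup\{|x|^{-2}a(x):x\in\mathbb{R}^n,\ x\ne0,\ |x|\le\delta\}<+\infty$ for some $\delta>0$, and let $\tilde N>N$ be an integer. Then there exists a family of constants $\tilde M_{\theta,\hat\theta},\tilde R_{\theta,\hat\theta}>0$, parameterized by $(\theta,\hat\theta)\in\mathbb{R}^l\times\mathbb{R}^l$, such that for every $\theta\in\mathbb{R}^l$,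 $x_0\in\mathbb{R}^n$, $\hat\theta_0\in\mathbb{R}^l$ with $|x_0|\le\tilde R_{\theta,\hat\theta_0}$ the solution of the hybrid closed-loop system (described in the context, with true parameter $\theta$) with initial conditions $x(0)=x_0$, $\hat\theta(0)=\hat\theta_0$ satisfies $$|x(t)|\le\tilde M_{\theta,\hat\theta_0}\exp(-\omega_\theta t)|x_0|\quad\text{for all }t\ge0,$$ where $\omega_\theta$ is the constant from (iv).
   Context: Notation. $|\cdot|$ is the Euclidean norm, a prime denotes transpose, $\mathbb{R}_+=[0,\infty)$, $\mathbb{Z}_+=\{0,1,2,\dots\}$. $V:\mathbb{R}^n\to\mathbb{R}_+$ is positive definite if $V(0)=0$ and $V(x)>0$ for $x\ne0$; a continuous $V$ is radially unbounded if $\{x: V(x)\le M\}$ is compact for every $M>0$. Hybrid closed-loop system. Given the data $f,g,k,V_\theta,Q_\theta,a,T,\tilde N$ and the (constant, unknown to the controller) parameter $\theta\in\mathbb{R}^l$, the plant is $$\dot x=f(x,u)+g(x,u)\theta,\qquad x\in\mathbb{R}^n,\ u\in\mathbb{R}^m.$$ The state $x(t)$ is continuous, and there is a sequence of event times $\tau_0=0<\tau_1<\tau_2<\dots$ such that for all $i\in\mathbb{Z}_+$: (1) Control: for $t\in[\tau_i,\tau_{i+1})$, $u(t)=k(\hat\theta(\tau_i),x(t))$ and $\hat\theta(t)=\hat\theta(\tau_i)$. (2) Event times: $\tau_{i+1}=\min(\tau_i+T,r_i)$, where, if $x(\tau_i)\ne0$, $$r_i=\inf\{t>\tau_i:\ V_{\hat\theta(\tau_i)}(x(t))=Q_{\hat\theta(\tau_i)}(x(\tau_i))+a(x(\tau_i))\}$$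 with $x(t)$ the solution of the plant with $u(t)=k(\hat\theta(\tau_i),x(t))$ ($r_i=+\infty$ if no such $t$ exists), and $r_i=\tau_i+T$ if $x(\tau_i)=0$. (3) Parameter update: let $\mu_{i+1}=\min\{\tau_j:\ j\in\{0,\dots,i\},\ \tau_j\ge\tau_{i+1}-\tilde N T\}$, $$p(t,\sigma)=x(t)-x(\sigma)-\int_\sigma^t f(x(s),u(s))\,ds,\qquad q(t,\sigma)=\int_\sigma^t g(x(s),u(s))\,ds,$$ $$G(\tau_{i+1},\mu_{i+1})=\int_{\mu_{i+1}}^{\tau_{i+1}}\!\int_{\mu_{i+1}}^{\tau_{i+1}}q'(t,\sigma)q(t,\sigma)\,d\sigma\,dt,\qquad Z(\tau_{i+1},\mu_{i+1})=\int_{\mu_{i+1}}^{\tau_{i+1}}\!\int_{\mu_{i+1}}^{\tau_{i+1}}q'(t,\sigma)p(t,\sigma)\,d\sigma\,dt.$$ Then $\hat\theta(\tau_{i+1})$ is the unique minimizer $$\hat\theta(\tau_{i+1})=\arg\min\{|\vartheta-\hat\theta(\tau_i)|^2:\ \vartheta\in\mathbb{R}^l,\ Z(\tau_{i+1},\mu_{i+1})=G(\tau_{i+1},\mu_{i+1})\vartheta\}.$$ *)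

theory Defs
  imports "HOL-Analysis.Analysis"
begin

section \<open>Smooth functions\<close>

text \<open>\<open>C_diff r f\<close>: \<open>f\<close> is of class \<open>C\<^sup>r\<close> on the whole space, expressed through directional
  values of the Frechet derivative. On finite-dimensional spaces, the only ones used below,
  this is the usual notion.\<close>

primrec C_diff :: "nat \<Rightarrow> ('a::real_normed_vector \<Rightarrow> 'b::real_normed_vector) \<Rightarrow> bool" where
  "C_diff 0 f \<longleftrightarrow> continuous_on UNIV f"
| "C_diff (Suc r) f \<longleftrightarrow>
     (\<forall>x. f differentiable (at x)) \<and> (\<forall>v. C_diff r (\<lambda>x. frechet_derivative f (at x) v))"

definition smooth :: "('a::real_normed_vector \<Rightarrow> 'b::real_normed_vector) \<Rightarrow> bool" where
  "smooth f \<longleftrightarrow> (\<forall>r. C_diff r f)"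


section \<open>Positive definite and radially unbounded functions\<close>

definition positive_definite :: "('a::real_normed_vector \<Rightarrow> real) \<Rightarrow> bool" where
  "positive_definite W \<longleftrightarrow> W 0 = 0 \<and> (\<forall>x. x \<noteq> 0 \<longrightarrow> W x > 0)"

definition radially_unbounded :: "('a::real_normed_vector \<Rightarrow> real) \<Rightarrow> bool" where
  "radially_unbounded W \<longleftrightarrow> (\<forall>M>0. compact {x. W x \<le> M})"


section \<open>Autonomous differential equations\<close>

text \<open>On an interval \<open>I\<close> the derivative at an endpoint belonging to \<open>I\<close> is one-sided.\<close>

definition ode_solution ::
  "('a::real_normed_vector \<Rightarrow> 'a) \<Rightarrow> real set \<Rightarrow> (real \<Rightarrow> 'a) \<Rightarrow> bool" where
  "ode_solution F I x \<longleftrightarrow> (\<forall>t\<in>I. (x has_vector_derivative F (x t)) (at t within I))"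

text \<open>Global existence of solutions, Lyapunov stability and global attractivity of the origin.\<close>

definition globally_asymptotically_stable :: "('a::real_normed_vector \<Rightarrow> 'a) \<Rightarrow> bool" where
  "globally_asymptotically_stable F \<longleftrightarrow>
     (\<forall>x0. \<exists>x. ode_solution F {0..} x \<and> x 0 = x0) \<and>
     (\<forall>\<epsilon>>0. \<exists>\<delta>>0. \<forall>x. ode_solution F {0..} x \<and> norm (x 0) < \<delta> \<longrightarrow> (\<forall>t\<ge>0. norm (x t) < \<epsilon>)) \<and>
     (\<forall>x. ode_solution F {0..} x \<longrightarrow> (x \<longlongrightarrow> 0) at_top)"


section \<open>The hybrid closed-loop system\<close>

text \<open>Right-hand side of the plant with true parameter \<open>\<theta>\<close> under the feedback \<open>u = k(\<eta>, x)\<close>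
  built from the parameter value \<open>\<eta>\<close>.\<close>

definition closed_loop_field ::
  "((real^'n) \<times> (real^'m) \<Rightarrow> real^'n) \<Rightarrow> ((real^'n) \<times> (real^'m) \<Rightarrow> real^'l^'n) \<Rightarrow>
   ((real^'l) \<times> (real^'n) \<Rightarrow> real^'m) \<Rightarrow> real^'l \<Rightarrow> real^'l \<Rightarrow> real^'n \<Rightarrow> real^'n" where
  "closed_loop_field f g k \<theta> \<eta> x = f (x, k (\<eta>, x)) + g (x, k (\<eta>, x)) *v \<theta>"

text \<open>The instant \<open>r\<^sub>i\<close> for \<open>s = \<tau>\<^sub>i\<close>, \<open>xs = x(\<tau>\<^sub>i)\<close> and \<open>\<eta>\<close> the parameter estimate at \<open>\<tau>\<^sub>i\<close>. The trajectory \<open>\<xi>\<close>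
  is the solution of the plant started at \<open>xs\<close> at time \<open>s\<close> with the estimate frozen; a time \<open>t\<close>
  counts only if this solution exists up to \<open>t\<close>. In \<^typ>\<open>ereal\<close> the infimum of the empty set is
  \<open>\<infinity>\<close>.\<close>

definition trigger_time ::
  "((real^'n) \<times> (real^'m) \<Rightarrow> real^'n) \<Rightarrow> ((real^'n) \<times> (real^'m) \<Rightarrow> real^'l^'n) \<Rightarrow>
   ((real^'l) \<times> (real^'n) \<Rightarrow> real^'m) \<Rightarrow> (real^'l \<Rightarrow> real^'n \<Rightarrow> real) \<Rightarrow>
   (real^'l \<Rightarrow> real^'n \<Rightarrow> real) \<Rightarrow> (real^'n \<Rightarrow> real) \<Rightarrow> real \<Rightarrow>
   real^'l \<Rightarrow> real^'l \<Rightarrow> real \<Rightarrow> real^'n \<Rightarrow> ereal" where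
  "trigger_time f g k V Q a T \<theta> \<eta> s xs =
     (if xs = 0 then ereal (s + T)
      else Inf (ereal ` {t. s < t \<and>
             (\<exists>\<xi>. ode_solution (closed_loop_field f g k \<theta> \<eta>) {s..t} \<xi> \<and> \<xi> s = xs \<and>
                  V \<eta> (\<xi> t) = Q \<eta> xs + a xs)}))"

text \<open>The interval integrals are oriented, as \<open>t < \<sigma>\<close> occurs in the double integrals below.\<close>

definition p_fun ::
  "((real^'n) \<times> (real^'m) \<Rightarrow> real^'n) \<Rightarrow> (real \<Rightarrow> real^'n) \<Rightarrow> (real \<Rightarrow> real^'m) \<Rightarrow>
   real \<Rightarrow> real \<Rightarrow> real^'n" where
  "p_fun f x u t \<sigma> = x t - x \<sigma> - (LBINT s=\<sigma>..t. f (x s, u s))"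

definition q_fun ::
  "((real^'n) \<times> (real^'m) \<Rightarrow> real^'l^'n) \<Rightarrow> (real \<Rightarrow> real^'n) \<Rightarrow> (real \<Rightarrow> real^'m) \<Rightarrow>
   real \<Rightarrow> real \<Rightarrow> real^'l^'n" where
  "q_fun g x u t \<sigma> = (LBINT s=\<sigma>..t. g (x s, u s))"

definition G_mat ::
  "((real^'n) \<times> (real^'m) \<Rightarrow> real^'l^'n) \<Rightarrow> (real \<Rightarrow> real^'n) \<Rightarrow> (real \<Rightarrow> real^'m) \<Rightarrow>
   real \<Rightarrow> real \<Rightarrow> real^'l^'l" where
  "G_mat g x u b \<mu> =
     (LBINT t=\<mu>..b. (LBINT \<sigma>=\<mu>..b. transpose (q_fun g x u t \<sigma>) ** q_fun g x u t \<sigma>))"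

definition Z_vec ::
  "((real^'n) \<times> (real^'m) \<Rightarrow> real^'n) \<Rightarrow> ((real^'n) \<times> (real^'m) \<Rightarrow> real^'l^'n) \<Rightarrow>
   (real \<Rightarrow> real^'n) \<Rightarrow> (real \<Rightarrow> real^'m) \<Rightarrow> real \<Rightarrow> real \<Rightarrow> real^'l" where
  "Z_vec f g x u b \<mu> =
     (LBINT t=\<mu>..b. (LBINT \<sigma>=\<mu>..b. transpose (q_fun g x u t \<sigma>) *v p_fun f x u t \<sigma>))"

text \<open>\<open>window_start \<tau> T N' i\<close> is \<open>\<mu>\<^sub>i\<^sub>+\<^sub>1\<close>.\<close>

definition window_start :: "(nat \<Rightarrow> real) \<Rightarrow> real \<Rightarrow> nat \<Rightarrow> nat \<Rightarrow> real" where
  "window_start \<tau> T N' i = Min {\<tau> j | j. j \<le> i \<and> \<tau> j \<ge> \<tau> (Suc i) - real N' * T}"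

text \<open>\<open>(x, u, \<theta>h, \<tau>)\<close> is a solution of the hybrid closed-loop system with true parameter \<open>\<theta>\<close> and
  initial conditions \<open>x0\<close>, \<open>\<theta>h0\<close>; \<open>\<theta>h\<close> is the parameter estimate. The solution is considered on
  the union of the intervals \<open>[\<tau>\<^sub>i, \<tau>\<^sub>i\<^sub>+\<^sub>1)\<close>. That this union is all of \<open>[0, \<infinity>)\<close>, i.e. that the
  event times do not accumulate, is not part of the definition.\<close>

definition hybrid_solution ::
  "((real^'n) \<times> (real^'m) \<Rightarrow> real^'n) \<Rightarrow> ((real^'n) \<times> (real^'m) \<Rightarrow> real^'l^'n) \<Rightarrow>
   ((real^'l) \<times> (real^'n) \<Rightarrow> real^'m) \<Rightarrow> (real^'l \<Rightarrow> real^'n \<Rightarrow> real) \<Rightarrow>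
   (real^'l \<Rightarrow> real^'n \<Rightarrow> real) \<Rightarrow> (real^'n \<Rightarrow> real) \<Rightarrow> real \<Rightarrow> nat \<Rightarrow>
   real^'l \<Rightarrow> real^'n \<Rightarrow> real^'l \<Rightarrow>
   (real \<Rightarrow> real^'n) \<Rightarrow> (real \<Rightarrow> real^'m) \<Rightarrow> (real \<Rightarrow> real^'l) \<Rightarrow> (nat \<Rightarrow> real) \<Rightarrow> bool" where
  "hybrid_solution f g k V Q a T N' \<theta> x0 \<theta>h0 x u \<theta>h \<tau> \<longleftrightarrow>
     x 0 = x0 \<and> \<theta>h 0 = \<theta>h0 \<and> \<tau> 0 = 0 \<and> strict_mono \<tau> \<and>
     continuous_on (\<Union>i. {\<tau> i..<\<tau> (Suc i)}) x \<and>
     (\<forall>i.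
        (\<forall>t\<in>{\<tau> i..<\<tau> (Suc i)}.
           u t = k (\<theta>h (\<tau> i), x t) \<and> \<theta>h t = \<theta>h (\<tau> i) \<and>
           (x has_vector_derivative f (x t, u t) + g (x t, u t) *v \<theta>)
             (at t within {\<tau> i..<\<tau> (Suc i)})) \<and>
        ereal (\<tau> (Suc i)) =
          min (ereal (\<tau> i + T)) (trigger_time f g k V Q a T \<theta> (\<theta>h (\<tau> i)) (\<tau> i) (x (\<tau> i))) \<and>
        (let b = \<tau> (Suc i); \<mu> = window_start \<tau> T N' i in
           \<forall>\<eta>. is_arg_min (\<lambda>\<zeta>. (norm (\<zeta> - \<theta>h (\<tau> i)))\<^sup>2)
                 (\<lambda>\<zeta>. Z_vec f g x u b \<mu> = G_mat g x u b \<mu> *v \<zeta>) \<eta>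
               \<longleftrightarrow> \<eta> = \<theta>h b))"

end

theory Submission
  imports Defs
begin

text \<open>The estimate can only be wrong about directions that left no trace in the data. Along a
  trajectory \<open>p(t,\<sigma>) = q(t,\<sigma>) \<theta>\<close>, so the true parameter \<open>\<theta>\<close> always solves the normal equations
  \<open>Z = G \<zeta>\<close>; as \<open>G\<close> is an integrated Gram matrix, any other solution differs from \<open>\<theta>\<close> by a
  vector \<open>v\<close> with \<open>g(x(t),u(t)) v = 0\<close> on the whole window (\<open>consistent_imp_regressor_kernel\<close>).
  Intervals have length at most \<open>T\<close> and \<open>N' > N\<close>, so the windows of the first \<open>N\<close> updates reach
  back to time 0. If none of the first \<open>N + 1\<close> estimates were \<open>\<theta>\<close>, their errors would therefore
  satisfy the premises of assumption (iii), and the trajectory would vanish. Hence a trajectory from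
  \<open>x0 \<noteq> 0\<close> has an exact estimate from \<open>\<tau>\<^sub>N\<close> on (\<open>identification\<close>): the update is the nearest-point
  projection onto an affine set containing \<open>\<theta>\<close>, so it never increases the error and keeps an exact
  estimate exact.

  From \<open>\<tau>\<^sub>N\<close> on the state follows the nominal system. There \<open>V \<le> Q < Q + a\<close> keeps the trigger
  silent (for a nonzero state), the events are \<open>T\<close> apart and do not accumulate, and (iv) gives the decay
  (\<open>follows_nominal_after_identification\<close>). Before that, all estimates lie in the ball around \<open>\<theta>\<close>
  through the initial estimate. The closed-loop fields with these estimates share a
  linear growth constant \<open>L\<close> near the origin, so, for small \<open>x0\<close>, \<open>\<bar>x(t)\<bar> \<le> exp (L t) \<bar>x0\<bar>\<close> up to the time
  \<open>\<tau>\<^sub>N \<le> N T\<close> (\<open>growth_bound\<close>). This costs only a constant factor, which depends on \<open>\<theta>\<close> and on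
  the initial estimate but not on \<open>x0\<close>. A trajectory from \<open>x0 = 0\<close> may never identify \<open>\<theta>\<close>, but it
  stays at the origin.

  Solutions exist (\<open>hybrid_solution_exists\<close>) because, until the trigger fires, the state is confined
  to a compact sublevel set of \<open>V\<close>, outside which the field may be truncated to a globally
  Lipschitz one; because the normal equations are always solvable; and because the intervals can be
  glued one after the other.\<close>

section \<open>Locally Lipschitz maps\<close>

text \<open>In finite dimension this is local Lipschitz continuity, in a form closed under composition
  without any chain rule: Lipschitz maps send balls into balls.\<close>

definition lipschitz_on_balls ::
  "('a::real_normed_vector \<Rightarrow> 'b::real_normed_vector) \<Rightarrow> bool" where
  "lipschitz_on_balls h \<longleftrightarrow> (\<forall>r. \<exists>L. L-lipschitz_on (cball 0 r) h)"

text \<open>By the mean value inequality: the partial derivatives are continuous, hence bounded on the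
  compact ball, and their norms sum to a bound on the operator norm of the derivative.\<close>

lemma smooth_imp_lipschitz_on_balls:
  fixes h :: "'a::euclidean_space \<Rightarrow> 'b::real_normed_vector"
  assumes "smooth h"
  shows "lipschitz_on_balls h"
  unfolding lipschitz_on_balls_def
proof
  fix r
  define D where "D x = frechet_derivative h (at x)" for x
  have "C_diff (Suc 0) h"
    using assms by (simp add: smooth_def del: C_diff.simps)
  then have der: "(h has_derivative D x) (at x)" and cont: "continuous_on UNIV (\<lambda>x. D x b)" for x b
    by (auto simp: D_def frechet_derivative_works)
  have "continuous_on (cball 0 r) (\<lambda>x. \<Sum>b\<in>Basis. norm (D x b))"
    by (intro continuous_intros continuous_on_subset[OF cont]) auto
  then have "bounded ((\<lambda>x. \<Sum>b\<in>Basis. norm (D x b)) ` cball 0 r)"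
    using compact_cball compact_continuous_image compact_imp_bounded by blast
  then obtain B where B: "\<And>x. x \<in> cball 0 r \<Longrightarrow> (\<Sum>b\<in>Basis. norm (D x b)) \<le> B"
    unfolding bounded_iff by (metis abs_ge_self image_eqI order_trans real_norm_def)
  have "norm (h x - h y) \<le> max B 0 * norm (x - y)" if "x \<in> cball 0 r" "y \<in> cball 0 r" for x y
  proof (rule differentiable_bound[OF convex_cball _ _ that])
    show "(h has_derivative D z) (at z within cball 0 r)" for z
      using der has_derivative_at_withinI by blast
    show "onorm (D z) \<le> max B 0" if "z \<in> cball 0 r" for z
      using onorm_componentwise[OF has_derivative_bounded_linear[OF der, of z]] B[OF that]
      by linarith
  qed
  then show "\<exists>L. L-lipschitz_on (cball 0 r) h"
    by (auto simp: lipschitz_on_def dist_norm intro!: exI[of _ "max B 0"])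
qed

lemma lipschitz_on_balls_bounded:
  assumes "lipschitz_on_balls h"
  obtains b where "\<And>x. norm x \<le> r \<Longrightarrow> norm (h x) \<le> b"
proof -
  obtain L where L: "L-lipschitz_on (cball 0 r) h"
    using assms by (auto simp: lipschitz_on_balls_def)
  have "norm (h x) \<le> norm (h 0) + L * r" if "norm x \<le> r" for x
  proof -
    have "0 \<in> cball (0::'a) r"
      using order_trans[OF norm_ge_zero that] by simp
    then have "norm (h x - h 0) \<le> L * norm (x - 0)"
      using that by (intro lipschitz_on_normD[OF L]) auto
    also have "\<dots> \<le> L * r"
      using that lipschitz_on_nonneg[OF L] by (simp add: mult_left_mono)
    finally show ?thesis
      using norm_triangle_sub[of "h x" "h 0"] by linarith
  qed
  then show thesis using that by blast
qed

lemma lipschitz_on_balls_compose: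
  assumes h: "lipschitz_on_balls h" and k: "lipschitz_on_balls k"
  shows "lipschitz_on_balls (\<lambda>x. h (k x))"
  unfolding lipschitz_on_balls_def
proof
  fix r
  obtain b where b: "\<And>x. norm x \<le> r \<Longrightarrow> norm (k x) \<le> b"
    using lipschitz_on_balls_bounded[OF k] by blast
  obtain L1 where L1: "L1-lipschitz_on (cball 0 b) h"
    using h by (auto simp: lipschitz_on_balls_def)
  obtain L2 where L2: "L2-lipschitz_on (cball 0 r) k"
    using k by (auto simp: lipschitz_on_balls_def)
  have "k ` cball 0 r \<subseteq> cball 0 b"
    using b by auto
  then have "(L1 * L2)-lipschitz_on (cball 0 r) (\<lambda>x. h (k x))"
    using lipschitz_on_compose2[OF L2] L1 lipschitz_on_mono by (metis order_refl)
  then show "\<exists>L. L-lipschitz_on (cball 0 r) (\<lambda>x. h (k x))" ..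
qed

lemma lipschitz_on_balls_Pair:
  assumes "lipschitz_on_balls h" "lipschitz_on_balls k"
  shows "lipschitz_on_balls (\<lambda>x. (h x, k x))"
  unfolding lipschitz_on_balls_def
proof
  fix r
  obtain L1 L2 where "L1-lipschitz_on (cball 0 r) h" "L2-lipschitz_on (cball 0 r) k"
    using assms by (meson lipschitz_on_balls_def)
  then show "\<exists>L. L-lipschitz_on (cball 0 r) (\<lambda>x. (h x, k x))"
    using lipschitz_on_Pair by blast
qed

lemma lipschitz_on_balls_add:
  assumes "lipschitz_on_balls h" "lipschitz_on_balls k"
  shows "lipschitz_on_balls (\<lambda>x. h x + k x)"
  unfolding lipschitz_on_balls_def
proof
  fix r
  obtain L1 L2 where "L1-lipschitz_on (cball 0 r) h" "L2-lipschitz_on (cball 0 r) k"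
    using assms by (meson lipschitz_on_balls_def)
  then show "\<exists>L. L-lipschitz_on (cball 0 r) (\<lambda>x. h x + k x)"
    using lipschitz_on_add by blast
qed

lemma lipschitz_on_balls_bounded_linear:
  assumes "bounded_linear h"
  shows "lipschitz_on_balls h"
proof -
  interpret h: bounded_linear h by fact
  obtain K where "K > 0" "\<And>x. norm (h x) \<le> norm x * K"
    using h.pos_bounded by blast
  then have "K-lipschitz_on (cball 0 r) h" for r
    by (intro lipschitz_onI) (auto simp: dist_norm h.diff[symmetric] mult.commute)
  then show ?thesis by (auto simp: lipschitz_on_balls_def)
qed

lemma lipschitz_on_balls_imp_continuous_on:
  fixes h :: "'a::real_normed_vector \<Rightarrow> 'b::real_normed_vector"
  assumes "lipschitz_on_balls h"
  shows "continuous_on UNIV h"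
proof -
  have "continuous_on (ball 0 r) h" for r
    using assms lipschitz_on_continuous_on lipschitz_on_subset[OF _ ball_subset_cball]
    unfolding lipschitz_on_balls_def by metis
  then have "continuous_on (\<Union>r. ball 0 r) h"
    by (intro continuous_on_open_UN) auto
  moreover have "(\<Union>r. ball (0::'a) r) = UNIV"
  proof -
    have "x \<in> ball 0 (norm x + 1)" for x :: 'a
      by simp
    then show ?thesis by blast
  qed
  ultimately show ?thesis by simp
qed

section \<open>Differential inequalities and differential equations\<close>

text \<open>The function \<open>\<bar>w\<bar>\<^sup>2 exp (- 2 L (r - s))\<close> has nonpositive derivative. Working with the square avoids
  the points where the norm is not differentiable. Taken with \<open>w\<close> a difference of two solutions this
  gives uniqueness, with \<open>w\<close> a single trajectory a growth bound.\<close>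

lemma gronwall:
  fixes w :: "real \<Rightarrow> 'a::real_inner"
  assumes "s \<le> t" and cont: "continuous_on {s..t} w"
    and der: "\<And>r. s < r \<Longrightarrow> r < t \<Longrightarrow> (w has_vector_derivative w' r) (at r)"
    and bound: "\<And>r. s < r \<Longrightarrow> r < t \<Longrightarrow> norm (w' r) \<le> L * norm (w r)"
  shows "norm (w t) \<le> exp (L * (t - s)) * norm (w s)"
proof -
  define \<phi> where "\<phi> r = (w r \<bullet> w r) * exp (- 2 * L * (r - s))" for r
  have "\<phi> t \<le> \<phi> s"
  proof (rule DERIV_nonpos_imp_decreasing_open[OF \<open>s \<le> t\<close>])
    show "continuous_on {s..t} \<phi>"
      unfolding \<phi>_def by (intro continuous_intros cont)
    fix r assume r: "s < r" "r < t"
    have "w r \<bullet> w' r \<le> norm (w r) * norm (w' r)"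
      by (rule norm_cauchy_schwarz)
    also have "\<dots> \<le> norm (w r) * (L * norm (w r))"
      by (intro mult_left_mono bound r) auto
    also have "\<dots> = L * (w r \<bullet> w r)"
      by (simp add: power2_norm_eq_inner[symmetric] power2_eq_square)
    finally have *: "w r \<bullet> w' r \<le> L * (w r \<bullet> w r)" .
    have "(\<phi> has_real_derivative
        (2 * (w r \<bullet> w' r) - 2 * L * (w r \<bullet> w r)) * exp (- 2 * L * (r - s))) (at r)"
      using der[OF r] unfolding \<phi>_def
      by (auto simp: has_vector_derivative_def has_field_derivative_def
          intro!: derivative_eq_intros ext) (simp add: algebra_simps inner_commute)
    moreover have "(2 * (w r \<bullet> w' r) - 2 * L * (w r \<bullet> w r)) * exp (- 2 * L * (r - s)) \<le> 0"
      using * by (intro mult_nonpos_nonneg) auto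
    ultimately show "\<exists>y. (\<phi> has_real_derivative y) (at r) \<and> y \<le> 0"
      by blast
  qed
  then have "(norm (w t))\<^sup>2 * exp (- 2 * L * (t - s)) * exp (2 * L * (t - s))
      \<le> (norm (w s))\<^sup>2 * exp (2 * L * (t - s))"
    by (intro mult_right_mono) (auto simp: \<phi>_def power2_norm_eq_inner)
  then have "(norm (w t))\<^sup>2 \<le> (norm (w s))\<^sup>2 * exp (2 * L * (t - s))"
    by (simp add: mult.assoc exp_add[symmetric])
  also have "\<dots> = (exp (L * (t - s)) * norm (w s))\<^sup>2"
    by (simp add: power_mult_distrib exp_double[symmetric] mult_ac)
  finally show ?thesis
    by (rule power2_le_imp_le) simp
qed

text \<open>If the growth condition is known on the unit ball only, it still suffices: at the first exit time
  from the ball the estimate would already give a norm below 1.\<close>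

lemma gronwall_local:
  fixes w :: "real \<Rightarrow> 'a::real_inner"
  assumes "s \<le> t" and cont: "continuous_on {s..t} w"
    and der: "\<And>r. s < r \<Longrightarrow> r < t \<Longrightarrow> (w has_vector_derivative w' r) (at r)"
    and bound: "\<And>r. s < r \<Longrightarrow> r < t \<Longrightarrow> norm (w r) \<le> 1 \<Longrightarrow> norm (w' r) \<le> L * norm (w r)"
    and small: "exp (L * (t - s)) * norm (w s) < 1" and "L \<ge> 0"
  shows "norm (w t) \<le> exp (L * (t - s)) * norm (w s)"
proof -
  have est: "norm (w r) \<le> exp (L * (r - s)) * norm (w s)"
    if r: "s \<le> r" "r \<le> t" and "\<And>q. s \<le> q \<Longrightarrow> q < r \<Longrightarrow> norm (w q) \<le> 1" for r
  proof (rule gronwall[where w' = w'])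
    show "continuous_on {s..r} w"
      using r by (intro continuous_on_subset[OF cont]) auto
    fix q assume "s < q" "q < r"
    then show "(w has_vector_derivative w' q) (at q)" "norm (w' q) \<le> L * norm (w q)"
      using that by (auto intro!: der bound)
  qed (use r in auto)
  have "norm (w q) < 1" if q: "s \<le> q" "q \<le> t" for q
  proof (rule ccontr)
    assume "\<not> norm (w q) < 1"
    \<comment> \<open>the infimum of this closed set is the first exit time from the open unit ball\<close>
    define S where "S = {s..t} \<inter> (\<lambda>r. norm (w r)) -` {1..}"
    have "closed S"
      unfolding S_def by (intro continuous_closed_preimage continuous_intros cont)
    moreover have "S \<noteq> {}" "bdd_below S"
      using q \<open>\<not> norm (w q) < 1\<close> by (auto simp: S_def)
    ultimately have c: "Inf S \<in> S"
      by (intro closed_contains_Inf)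
    have "norm (w r) \<le> 1" if "s \<le> r" "r < Inf S" for r
      using that c cInf_lower[OF _ \<open>bdd_below S\<close>, of r] by (force simp: S_def)
    then have "norm (w (Inf S)) \<le> exp (L * (Inf S - s)) * norm (w s)"
      using c by (intro est) (auto simp: S_def)
    also have "\<dots> \<le> exp (L * (t - s)) * norm (w s)"
      using c \<open>L \<ge> 0\<close> by (intro mult_right_mono) (auto simp: S_def mult_left_mono)
    finally show False
      using small c by (auto simp: S_def)
  qed
  then show ?thesis
    using \<open>s \<le> t\<close> by (intro est) (auto simp: less_imp_le)
qed

lemma ode_solution_subset:
  assumes "ode_solution F I x" "J \<subseteq> I"
  shows "ode_solution F J x"
  using assms unfolding ode_solution_def by (meson has_vector_derivative_within_subset subsetD)

lemma ode_solution_continuous_on: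
  assumes "ode_solution F I x"
  shows "continuous_on I x"
  using assms unfolding ode_solution_def
  by (meson continuous_on_eq_continuous_within has_vector_derivative_continuous)

lemma ode_solution_shift:
  assumes "ode_solution F {0..} x" "I \<subseteq> {s..}"
  shows "ode_solution F I (\<lambda>t. x (t - s))"
  unfolding ode_solution_def
proof
  fix t assume "t \<in> I"
  have "(x has_vector_derivative F (x (t - s))) (at (t - s) within (\<lambda>t. t - s) ` I)"
    by (rule has_vector_derivative_within_subset[where S = "{0..}"])
      (use assms \<open>t \<in> I\<close> in \<open>auto simp: ode_solution_def\<close>)
  moreover have "((\<lambda>t. t - s) has_vector_derivative 1) (at t within I)"
    by (auto intro!: derivative_eq_intros)
  ultimately show "((\<lambda>t. x (t - s)) has_vector_derivative F (x (t - s))) (at t within I)"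
    using vector_diff_chain_within[of "\<lambda>t. t - s" 1 t I x] by (simp add: o_def)
qed

text \<open>The equation is required on the half-open interval only, with continuity up to the end point:
  this is what a sampling interval provides, as the control jumps at its right end.\<close>

lemma ode_solution_unique:
  fixes F :: "'a::euclidean_space \<Rightarrow> 'a"
  assumes F: "lipschitz_on_balls F"
    and x: "continuous_on {s..t} x" "ode_solution F {s..<t} x"
    and y: "continuous_on {s..t} y" "ode_solution F {s..<t} y"
    and "x s = y s" "r \<in> {s..t}"
  shows "x r = y r"
proof -
  have "bounded (x ` {s..t} \<union> y ` {s..t})"
    using x y by (simp add: compact_continuous_image compact_imp_bounded)
  then obtain B where B: "\<And>q. q \<in> {s..t} \<Longrightarrow> x q \<in> cball 0 B \<and> y q \<in> cball 0 B"
    unfolding bounded_iff by (metis UnI1 UnI2 image_eqI mem_cball_0)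
  obtain L where L: "L-lipschitz_on (cball 0 B) F"
    using F by (auto simp: lipschitz_on_balls_def)
  have "norm (x r - y r) \<le> exp (L * (r - s)) * norm (x s - y s)"
  proof (rule gronwall[where w' = "\<lambda>q. F (x q) - F (y q)"])
    show "continuous_on {s..r} (\<lambda>q. x q - y q)"
      using \<open>r \<in> {s..t}\<close>
      by (intro continuous_intros continuous_on_subset[OF x(1)] continuous_on_subset[OF y(1)]) auto
    fix q assume q: "s < q" "q < r"
    then have "q \<in> {s<..<t}"
      using \<open>r \<in> {s..t}\<close> by auto
    moreover have "{s<..<t} \<subseteq> {s..<t}" by auto
    ultimately have "(x has_vector_derivative F (x q)) (at q)" "(y has_vector_derivative F (y q)) (at q)"
      using ode_solution_subset[OF x(2) \<open>{s<..<t} \<subseteq> {s..<t}\<close>]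
        ode_solution_subset[OF y(2) \<open>{s<..<t} \<subseteq> {s..<t}\<close>]
      by (auto simp: ode_solution_def at_within_open[OF _ open_greaterThanLessThan])
    then show "((\<lambda>q. x q - y q) has_vector_derivative F (x q) - F (y q)) (at q)"
      by (rule has_vector_derivative_diff)
    show "norm (F (x q) - F (y q)) \<le> L * norm (x q - y q)"
      using B[of q] \<open>q \<in> {s<..<t}\<close> by (intro lipschitz_on_normD[OF L]) auto
  qed (use \<open>r \<in> {s..t}\<close> in auto)
  then show ?thesis
    using \<open>x s = y s\<close> by simp
qed

text \<open>Picard iteration as a single contraction on the whole interval, however long. Writing
  \<open>y = E z\<close> with \<open>E t = exp ((L + 1) (t - s))\<close> amounts to a weighted supremum norm, for which the
  integral operator contracts by the factor \<open>L / (L + 1)\<close>.\<close>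

lemma lipschitz_imp_ode_solution:
  fixes F :: "'a::euclidean_space \<Rightarrow> 'a"
  assumes F: "L-lipschitz_on UNIV F" and "s \<le> b"
  shows "\<exists>y. y s = x0 \<and> ode_solution F {s..b} y"
proof -
  have "L \<ge> 0"
    using F by (rule lipschitz_on_nonneg)
  have contF: "continuous_on UNIV F"
    using F by (rule lipschitz_on_continuous_on)
  define E where "E t = exp ((L + 1) * (t - s))" for t
  have E: "E t > 0" "E s = 1" for t
    by (auto simp: E_def)
  have contE: "continuous_on S E" for S
    unfolding E_def by (intro continuous_intros)
  have derE: "((\<lambda>t. E t / (L + 1)) has_vector_derivative E t) (at t within S)" for t S
    unfolding E_def has_real_derivative_iff_has_vector_derivative[symmetric]
    using \<open>L \<ge> 0\<close> by (auto intro!: derivative_eq_intros)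
  define G where "G z t = x0 + integral {s..t} (\<lambda>r. F (E r *\<^sub>R z r))" for z :: "real \<Rightarrow> 'a" and t
  have contz: "continuous_on S (\<lambda>r. F (E r *\<^sub>R apply_bcontfun z r))" for z S
    by (intro continuous_on_compose2[OF contF] continuous_intros contE) auto
  have derG: "(G (apply_bcontfun z) has_vector_derivative F (E t *\<^sub>R z t)) (at t within {s..b})"
    if "t \<in> {s..b}" for z t
    unfolding G_def
    using integral_has_vector_derivative[OF contz that]
    by (auto intro!: derivative_eq_intros)
  \<comment> \<open>the fixed point is sought among bounded continuous functions on the whole line, so functions on the interval are extended by constants\<close>
  have "\<exists>h :: real \<Rightarrow>\<^sub>C 'a. \<forall>t. h t = (1 / E (clamp s b t)) *\<^sub>R G z (clamp s b t)" for z :: "real \<Rightarrow>\<^sub>C 'a"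
  proof -
    have "continuous_on (cbox s b) (\<lambda>t. (1 / E t) *\<^sub>R G z t)"
    proof (intro continuous_intros contE)
      show "\<forall>t\<in>cbox s b. E t \<noteq> 0"
        using E(1) by (simp add: less_imp_neq[symmetric])
      show "continuous_on (cbox s b) (G z)"
        unfolding cbox_interval continuous_on_eq_continuous_within
        using derG has_vector_derivative_continuous by blast
    qed
    then show ?thesis
      by (rule continuous_on_cbox_bcontfunE) blast
  qed
  then obtain \<Phi> :: "(real \<Rightarrow>\<^sub>C 'a) \<Rightarrow> (real \<Rightarrow>\<^sub>C 'a)"
    where \<Phi>: "\<And>z t. \<Phi> z t = (1 / E (clamp s b t)) *\<^sub>R G z (clamp s b t)"
    by metis
  have contr: "dist (\<Phi> z) (\<Phi> w) \<le> L / (L + 1) * dist z w" for z w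
  proof (rule dist_bound)
    fix q
    define t where "t = clamp s b q"
    have t: "s \<le> t" "t \<le> b"
      using clamp_in_interval[of s b q] \<open>s \<le> b\<close> by (auto simp: t_def)
    have int: "(\<lambda>r. F (E r *\<^sub>R apply_bcontfun z r)) integrable_on {s..t}" for z
      by (intro integrable_continuous_real contz)
    have intE: "((\<lambda>r. L * dist z w * E r) has_integral L * dist z w * (E t / (L + 1) - E s / (L + 1))) {s..t}"
      by (intro has_integral_mult_right fundamental_theorem_of_calculus derE t)
    have "dist (\<Phi> z q) (\<Phi> w q) = norm ((1 / E t) *\<^sub>R (G z t - G w t))"
      by (simp add: \<Phi> dist_norm t_def scaleR_diff_right)
    also have "\<dots> = (1 / E t) * norm (integral {s..t} (\<lambda>r. F (E r *\<^sub>R z r) - F (E r *\<^sub>R w r)))"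
      using E(1)[of t] by (simp add: G_def integral_diff int)
    also have "norm (integral {s..t} (\<lambda>r. F (E r *\<^sub>R z r) - F (E r *\<^sub>R w r)))
        \<le> integral {s..t} (\<lambda>r. L * dist z w * E r)"
    proof (rule integral_norm_bound_integral)
      fix r assume "r \<in> {s..t}"
      have "norm (F (E r *\<^sub>R z r) - F (E r *\<^sub>R w r)) \<le> L * norm (E r *\<^sub>R z r - E r *\<^sub>R w r)"
        by (rule lipschitz_on_normD[OF F]) auto
      also have "\<dots> = L * (E r * dist (z r) (w r))"
        using E(1)[of r] by (simp add: dist_norm scaleR_diff_right[symmetric])
      also have "\<dots> \<le> L * (E r * dist z w)"
        using E(1)[of r] \<open>L \<ge> 0\<close> by (intro mult_left_mono dist_bounded) auto
      finally show "norm (F (E r *\<^sub>R z r) - F (E r *\<^sub>R w r)) \<le> L * dist z w * E r"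
        by (simp add: mult_ac)
    qed (use intE int in \<open>auto intro!: integrable_diff\<close>)
    also have "\<dots> = L * dist z w * (E t - 1) / (L + 1)"
      using integral_unique[OF intE] by (simp add: E diff_divide_distrib right_diff_distrib)
    also have "1 / E t * (L * dist z w * (E t - 1) / (L + 1)) \<le> L / (L + 1) * dist z w"
    proof -
      have "(E t - 1) / E t \<le> 1"
        using E(1)[of t] by simp
      then have "(L / (L + 1) * dist z w) * ((E t - 1) / E t) \<le> (L / (L + 1) * dist z w) * 1"
        using \<open>L \<ge> 0\<close> by (intro mult_left_mono) auto
      then show ?thesis by (simp add: field_simps)
    qed
    finally show "dist (\<Phi> z q) (\<Phi> w q) \<le> L / (L + 1) * dist z w"
      using E(1)[of t] by (simp add: divide_right_mono)
  qed
  obtain z where z: "\<Phi> z = z"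
    using banach_fix_type[of "L / (L + 1)" \<Phi>] contr \<open>L \<ge> 0\<close> by auto
  define y where "y t = E t *\<^sub>R z t" for t
  have y: "y t = G z t" if "t \<in> {s..b}" for t
  proof -
    have "clamp s b t = t"
      using that by (intro clamp_cancel_cbox) auto
    then have "z t = (1 / E t) *\<^sub>R G z t"
      using \<Phi>[of z t] z by simp
    then show ?thesis
      using E(1)[of t] by (simp add: y_def)
  qed
  have "y s = x0"
    using y[of s] \<open>s \<le> b\<close> by (simp add: G_def)
  moreover have "ode_solution F {s..b} y"
    unfolding ode_solution_def
  proof
    fix t assume t: "t \<in> {s..b}"
    have "(G z has_vector_derivative F (y t)) (at t within {s..b})"
      using derG[OF t, of z] by (simp add: y_def)
    then show "(y has_vector_derivative F (y t)) (at t within {s..b})"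
      by (rule has_vector_derivative_transform[OF t, rotated]) (use y in auto)
  qed
  ultimately show ?thesis by blast
qed

section \<open>The plant between two events\<close>

lemma bounded_linear_matrix_vector_mult_left:
  fixes v :: "real^'l"
  shows "bounded_linear (\<lambda>A::real^'l^'n. A *v v)"
  unfolding linear_conv_bounded_linear[symmetric]
  by (rule linearI) (simp_all add: matrix_vector_mult_add_rdistrib scaleR_matrix_vector_assoc)

text \<open>The facts about \<open>V\<close>, \<open>Q\<close> and \<open>a\<close> that make one sampling interval well defined: sublevel sets of \<open>V\<close>
  are compact, and a nonzero state lies strictly below its trigger level, so that the trigger
  cannot fire at once.\<close>

locale triggered_loop =
  fixes f :: "(real^'n) \<times> (real^'m) \<Rightarrow> real^'n"
    and g :: "(real^'n) \<times> (real^'m) \<Rightarrow> real^'l^'n"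
    and k :: "(real^'l) \<times> (real^'n) \<Rightarrow> real^'m"
    and V Q :: "real^'l \<Rightarrow> real^'n \<Rightarrow> real"
    and a :: "real^'n \<Rightarrow> real"
    and T :: real
  assumes lipschitz: "lipschitz_on_balls f" "lipschitz_on_balls g" "lipschitz_on_balls k"
    and equilibrium: "f (0, 0) = 0" "g (0, 0) = 0" "\<And>\<eta>. k (\<eta>, 0) = 0"
    and V_continuous: "\<And>\<eta>. continuous_on UNIV (V \<eta>)"
    and V_unbounded: "\<And>\<eta>. radially_unbounded (V \<eta>)"
    and V_nonneg: "\<And>\<eta> x. V \<eta> x \<ge> 0"
    and below_threshold: "\<And>\<eta> x. x \<noteq> 0 \<Longrightarrow> V \<eta> x < Q \<eta> x + a x"
    and T_pos: "T > 0"
begin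

abbreviation F :: "real^'l \<Rightarrow> real^'l \<Rightarrow> real^'n \<Rightarrow> real^'n" where
  "F \<equiv> closed_loop_field f g k"

lemma field_joint_lipschitz: "lipschitz_on_balls (\<lambda>p. F \<theta> (fst p) (snd p))"
proof -
  have pair: "lipschitz_on_balls (\<lambda>p. (snd p, k p))"
    by (intro lipschitz_on_balls_Pair lipschitz_on_balls_bounded_linear bounded_linear_snd lipschitz)
  have "lipschitz_on_balls (\<lambda>p. f (snd p, k p) + g (snd p, k p) *v \<theta>)"
    by (intro lipschitz_on_balls_add
        lipschitz_on_balls_compose[OF lipschitz_on_balls_bounded_linear[OF bounded_linear_matrix_vector_mult_left]]
        lipschitz_on_balls_compose[OF lipschitz(1) pair] lipschitz_on_balls_compose[OF lipschitz(2) pair])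
  then show ?thesis
    by (simp add: closed_loop_field_def)
qed

lemma field_lipschitz: "lipschitz_on_balls (F \<theta> \<eta>)"
proof -
  have "lipschitz_on_balls (\<lambda>x::real^'n. (\<eta>, x))"
    by (rule lipschitz_on_balls_Pair)
      (auto simp: lipschitz_on_balls_def intro: lipschitz_on_constant lipschitz_on_id)
  from lipschitz_on_balls_compose[OF field_joint_lipschitz this] show ?thesis
    by simp
qed

lemma field_zero: "F \<theta> \<eta> 0 = 0"
  by (simp add: closed_loop_field_def equilibrium)

text \<open>One constant serves all estimates in a bounded set, since the field is Lipschitz jointly in estimate
  and state and vanishes at the origin for every estimate.\<close>

lemma field_linear_growth:
  assumes "bounded \<Theta>"
  obtains L where "L \<ge> 0" "\<And>\<eta> x. \<eta> \<in> \<Theta> \<Longrightarrow> norm x \<le> 1 \<Longrightarrow> norm (F \<theta> \<eta> x) \<le> L * norm x"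
proof -
  obtain B where B: "\<And>\<eta>. \<eta> \<in> \<Theta> \<Longrightarrow> norm \<eta> \<le> B"
    using assms by (auto simp: bounded_iff)
  obtain L where L: "L-lipschitz_on (cball 0 (B + 1)) (\<lambda>p. F \<theta> (fst p) (snd p))"
    using field_joint_lipschitz by (auto simp: lipschitz_on_balls_def)
  have "norm (F \<theta> \<eta> x) \<le> L * norm x" if "\<eta> \<in> \<Theta>" "norm x \<le> 1" for \<eta> x
  proof -
    have "norm (\<eta>, x) \<le> B + 1" "norm (\<eta>, 0::real^'n) \<le> B + 1"
      using B[OF that(1)] that(2) norm_Pair_le[of \<eta> x] norm_Pair_le[of \<eta> "0::real^'n"] by auto
    then have "norm (F \<theta> \<eta> x - F \<theta> \<eta> 0) \<le> L * norm ((\<eta>, x) - (\<eta>, 0))"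
      using lipschitz_on_normD[OF L, of "(\<eta>, x)" "(\<eta>, 0)"] by simp
    then show ?thesis
      by (simp add: field_zero)
  qed
  then show thesis
    using that lipschitz_on_nonneg[OF L] by blast
qed

text \<open>The frozen-estimate field need not have global solutions, but below the trigger level the state
  stays in a compact sublevel set of \<open>V\<close>. The field is precomposed with the projection onto a ball
  containing that set; the solution of the truncated equation solves the original one up to its
  first crossing of the level, and by uniqueness no solution of the original equation crosses
  earlier.\<close>

lemma interval_step_exists:
  "\<exists>b y. s < b \<and> ereal b = min (ereal (s + T)) (trigger_time f g k V Q a T \<theta> \<eta> s xs) \<and>
     y s = xs \<and> ode_solution (F \<theta> \<eta>) {s..b} y"
proof (cases "xs = 0")
  case True
  then show ?thesis
    using T_pos
    by (intro exI[of _ "s + T"] exI[of _ "\<lambda>_. 0"])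
      (auto simp: trigger_time_def ode_solution_def field_zero)
next
  case False
  define c where "c = Q \<eta> xs + a xs"
  have "V \<eta> xs < c"
    using below_threshold[OF False] by (simp add: c_def)
  then have "c > 0"
    using V_nonneg[of \<eta> xs] by linarith
  then have "compact {x. V \<eta> x \<le> c}"
    using V_unbounded by (auto simp: radially_unbounded_def)
  then obtain B where "\<forall>x\<in>{x. V \<eta> x \<le> c}. norm x \<le> B"
    using compact_imp_bounded bounded_iff by metis
  then have B: "\<And>x. V \<eta> x \<le> c \<Longrightarrow> x \<in> cball 0 B"
    by simp
  have "xs \<in> cball 0 B"
    using B \<open>V \<eta> xs < c\<close> by simp
  then have ball: "cball (0::real^'n) B \<noteq> {}"
    by blast
  obtain L where L: "L-lipschitz_on (cball 0 B) (F \<theta> \<eta>)"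
    using field_lipschitz lipschitz_on_balls_def by blast
  \<comment> \<open>projection onto a ball is nonexpansive, so this truncation is globally Lipschitz\<close>
  define F' where "F' x = F \<theta> \<eta> (closest_point (cball 0 B) x)" for x
  have F'_eq: "F' x = F \<theta> \<eta> x" if "x \<in> cball 0 B" for x
    using that by (simp add: F'_def closest_point_self)
  have "1-lipschitz_on UNIV (closest_point (cball (0::real^'n) B))"
    using closest_point_lipschitz[OF convex_cball closed_cball ball] by (intro lipschitz_onI) auto
  moreover have "L-lipschitz_on (range (closest_point (cball (0::real^'n) B))) (F \<theta> \<eta>)"
    by (rule lipschitz_on_subset[OF L]) (use closest_point_in_set[OF closed_cball ball] in auto)
  ultimately have "(L * 1)-lipschitz_on UNIV F'"
    unfolding F'_def by (intro lipschitz_on_compose2)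
  then obtain y where y0: "y s = xs" and y: "ode_solution F' {s..s + T} y"
    using lipschitz_imp_ode_solution[of "L * 1" F' s "s + T" xs] T_pos by auto
  have contV: "continuous_on {s..s + T} (\<lambda>t. V \<eta> (y t))"
    by (intro continuous_on_compose2[OF V_continuous ode_solution_continuous_on[OF y]]) auto
  have sol: "ode_solution (F \<theta> \<eta>) {s..t} y"
    if "t \<le> s + T" and "\<And>r. s \<le> r \<Longrightarrow> r \<le> t \<Longrightarrow> V \<eta> (y r) \<le> c" for t
    using ode_solution_subset[OF y, of "{s..t}"] that F'_eq[OF B] by (auto simp: ode_solution_def)
  have no_crossing: False
    if t: "s < t" "t \<le> s + T" and below: "\<And>r. s \<le> r \<Longrightarrow> r \<le> t \<Longrightarrow> V \<eta> (y r) < c"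
      and \<xi>: "ode_solution (F \<theta> \<eta>) {s..t} \<xi>" "\<xi> s = xs" "V \<eta> (\<xi> t) = c" for t \<xi>
  proof -
    have sy: "ode_solution (F \<theta> \<eta>) {s..t} y"
      using sol[OF t(2)] below less_imp_le by blast
    have "y t = \<xi> t"
      using t y0 \<xi>(2) sy \<xi>(1)
      by (intro ode_solution_unique[OF field_lipschitz])
        (auto intro: ode_solution_continuous_on ode_solution_subset)
    then show False
      using below[of t] \<xi>(3) t by simp
  qed
  define Tr where "Tr = {t. s < t \<and> (\<exists>\<xi>. ode_solution (F \<theta> \<eta>) {s..t} \<xi> \<and> \<xi> s = xs \<and> V \<eta> (\<xi> t) = c)}"
  have trigger: "trigger_time f g k V Q a T \<theta> \<eta> s xs = Inf (ereal ` Tr)"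
    using False by (simp add: trigger_time_def Tr_def c_def)
  define S where "S = {s..s + T} \<inter> (\<lambda>t. V \<eta> (y t)) -` {c..}"
  show ?thesis
  proof (cases "S = {}")
    case True
    then have below: "V \<eta> (y r) < c" if "s \<le> r" "r \<le> s + T" for r
      using that by (force simp: S_def)
    have "s + T < t" if "t \<in> Tr" for t
    proof (rule ccontr)
      assume "\<not> s + T < t"
      with that below no_crossing[of t] show False
        by (fastforce simp: Tr_def)
    qed
    then have "ereal (s + T) \<le> Inf (ereal ` Tr)"
      by (intro Inf_greatest) (auto simp: less_imp_le)
    then show ?thesis
      using T_pos y0 sol[of "s + T"] below less_imp_le
      by (intro exI[of _ "s + T"] exI[of _ y]) (auto simp: trigger min_def)
  next
    case S: False
    define b where "b = Inf S"
    have "closed S"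
      unfolding S_def by (intro continuous_closed_preimage contV) auto
    moreover have "bdd_below S"
      by (auto simp: S_def)
    ultimately have "b \<in> S"
      using S by (simp add: b_def closed_contains_Inf)
    then have b: "s \<le> b" "b \<le> s + T" "c \<le> V \<eta> (y b)"
      by (auto simp: S_def)
    then have "s < b"
      using y0 \<open>V \<eta> xs < c\<close> by (cases "s = b") auto
    have below: "V \<eta> (y r) < c" if "s \<le> r" "r < b" for r
    proof (rule ccontr)
      assume "\<not> V \<eta> (y r) < c"
      then have "r \<in> S"
        using that b by (auto simp: S_def)
      then show False
        using cInf_lower[OF _ \<open>bdd_below S\<close>, of r] that by (simp add: b_def)
    qed
    have "V \<eta> (y b) \<le> c"
    proof (rule tendsto_upperbound)
      have "((\<lambda>t. V \<eta> (y t)) \<longlongrightarrow> V \<eta> (y b)) (at b within {s..s + T})"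
        using contV b by (simp add: continuous_on_def)
      then show "((\<lambda>t. V \<eta> (y t)) \<longlongrightarrow> V \<eta> (y b)) (at b within {s..<b})"
        by (rule tendsto_within_subset) (use b in auto)
      show "\<forall>\<^sub>F t in at b within {s..<b}. V \<eta> (y t) \<le> c"
        using below by (auto simp: eventually_at_filter less_imp_le)
      show "at b within {s..<b} \<noteq> bot"
        using \<open>s < b\<close> by (simp add: at_within_eq_bot_iff)
    qed
    with b have Vb: "V \<eta> (y b) = c"
      by simp
    have soly: "ode_solution (F \<theta> \<eta>) {s..b} y"
      by (rule sol[OF b(2)]) (use below Vb in \<open>force simp: le_less\<close>)
    have "b \<in> Tr"
      using \<open>s < b\<close> soly y0 Vb by (auto simp: Tr_def)
    moreover have "b \<le> t" if "t \<in> Tr" for t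
    proof (rule ccontr)
      assume "\<not> b \<le> t"
      with that below no_crossing[of t] b show False
        by (fastforce simp: Tr_def)
    qed
    ultimately have "Inf (ereal ` Tr) = ereal b"
      by (intro antisym Inf_greatest Inf_lower) auto
    then show ?thesis
      using \<open>s < b\<close> b y0 soly by (intro exI[of _ b] exI[of _ y]) (auto simp: trigger min_def)
  qed
qed

text \<open>With the exact estimate the state follows the nominal system, where \<open>V\<close> stays at or below \<open>Q xs\<close>,
  hence strictly below the trigger level \<open>Q xs + a xs\<close>.\<close>

lemma no_trigger_under_true_parameter:
  assumes solutions: "\<And>x0. \<exists>y. ode_solution (F \<theta> \<theta>) {0..} y \<and> y 0 = x0"
    and bound: "\<And>y t. ode_solution (F \<theta> \<theta>) {0..} y \<Longrightarrow> t \<ge> 0 \<Longrightarrow> V \<theta> (y t) \<le> Q \<theta> (y 0)"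
    and a_pos: "\<And>x. x \<noteq> 0 \<Longrightarrow> a x > 0"
  shows "ereal (s + T) \<le> trigger_time f g k V Q a T \<theta> \<theta> s xs"
proof (cases "xs = 0")
  case True
  then show ?thesis by (simp add: trigger_time_def)
next
  case False
  obtain y where y: "ode_solution (F \<theta> \<theta>) {0..} y" "y 0 = xs"
    using solutions by blast
  have "V \<theta> (\<xi> t) \<noteq> Q \<theta> xs + a xs"
    if "s < t" "ode_solution (F \<theta> \<theta>) {s..t} \<xi>" "\<xi> s = xs" for t \<xi>
  proof -
    have sy: "ode_solution (F \<theta> \<theta>) {s..t} (\<lambda>r. y (r - s))"
      by (rule ode_solution_shift[OF y(1)]) auto
    have "{s..<t} \<subseteq> {s..t}" by auto
    note ode_solution_unique[OF field_lipschitz ode_solution_continuous_on[OF that(2)]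
        ode_solution_subset[OF that(2) this] ode_solution_continuous_on[OF sy]
        ode_solution_subset[OF sy this], of t]
    then have "\<xi> t = y (t - s)"
      using that y(2) by simp
    then show ?thesis
      using bound[OF y(1), of "t - s"] that y(2) a_pos[OF False] by simp
  qed
  then show ?thesis
    using False by (auto simp: trigger_time_def intro!: Inf_greatest)
qed

end

section \<open>The normal equations\<close>

lemma interval_integral_eq_integral_diff:
  fixes h :: "real \<Rightarrow> 'a::euclidean_space"
  assumes h: "set_integrable lborel {\<mu>..b} h" and "t \<in> {\<mu>..b}" "\<sigma> \<in> {\<mu>..b}"
  shows "(LBINT s=\<sigma>..t. h s) = integral {\<mu>..t} h - integral {\<mu>..\<sigma>} h"
proof -
  have hk: "h integrable_on {\<mu>..b}"
    by (rule set_borel_integral_eq_integral(1)[OF h])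
  have le: "(LBINT s=\<sigma>..t. h s) = integral {\<mu>..t} h - integral {\<mu>..\<sigma>} h"
    if "\<sigma> \<in> {\<mu>..b}" "t \<in> {\<mu>..b}" "\<sigma> \<le> t" for \<sigma> t
  proof -
    have "(LBINT s=\<sigma>..t. h s) = integral {\<sigma>..t} h"
      using that by (intro interval_integral_eq_integral set_integrable_subset[OF h]) auto
    moreover have "integral {\<mu>..\<sigma>} h + integral {\<sigma>..t} h = integral {\<mu>..t} h"
      using that by (intro Henstock_Kurzweil_Integration.integral_combine
          integrable_on_subinterval[OF hk]) auto
    ultimately show ?thesis
      by (simp add: algebra_simps)
  qed
  show ?thesis
  proof (cases "\<sigma> \<le> t")
    case True
    then show ?thesis using le assms by blast
  next
    case False
    then show ?thesis
      using le[of t \<sigma>] assms interval_integral_endpoints_reverse[of "ereal \<sigma>" "ereal t" h] by simp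
  qed
qed

lemma continuous_on_slice:
  assumes "continuous_on (A \<times> B) (\<lambda>(t, \<sigma>). h t \<sigma>)" "t \<in> A"
  shows "continuous_on B (h t)"
proof -
  have "continuous_on B (Pair t)"
    by (intro continuous_intros)
  from continuous_on_compose2[OF assms(1) this] show ?thesis
    using assms(2) by auto
qed

lemma continuous_on_gram_matrix:
  fixes h :: "'a::topological_space \<Rightarrow> real^'l^'n"
  assumes "continuous_on S h"
  shows "continuous_on S (\<lambda>z. transpose (h z) ** h z)"
  unfolding matrix_matrix_mult_def transpose_def vec_lambda_beta
  by (intro continuous_on_vec_lambda continuous_on_sum continuous_on_mult continuous_on_component assms)

lemma inner_gram_matrix:
  fixes A :: "real^'l^'n"
  shows "v \<bullet> ((transpose A ** A) *v v) = (norm (A *v v))\<^sup>2"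
proof -
  have "v \<bullet> ((transpose A ** A) *v v) = ((A *v v) v* A) \<bullet> v"
    by (simp add: matrix_vector_mul_assoc[symmetric] transpose_matrix_vector inner_commute)
  then show ?thesis
    by (simp add: dot_lmul_matrix power2_norm_eq_inner)
qed

text \<open>On a window \<open>[\<mu>, b]\<close> where the regressor \<open>g(x,u)\<close> is integrable, \<open>q(t,\<sigma>)\<close> is the increment of a
  continuous primitive. The oriented Lebesgue integrals thereby become ordinary integrals of
  continuous functions over the square.\<close>

context
  fixes g :: "(real^'n) \<times> (real^'m) \<Rightarrow> real^'l^'n"
    and x :: "real \<Rightarrow> real^'n" and u :: "real \<Rightarrow> real^'m" and \<mu> b :: real
  assumes le: "\<mu> \<le> b"
    and integrable: "set_integrable lborel {\<mu>..b} (\<lambda>s. g (x s, u s))"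
begin

abbreviation (input) "primitive t \<equiv> integral {\<mu>..t} (\<lambda>s. g (x s, u s))"

lemma q_fun_eq_primitive_diff:
  assumes "t \<in> {\<mu>..b}" "\<sigma> \<in> {\<mu>..b}"
  shows "q_fun g x u t \<sigma> = primitive t - primitive \<sigma>"
  unfolding q_fun_def by (rule interval_integral_eq_integral_diff[OF integrable assms])

lemma primitive_continuous: "continuous_on {\<mu>..b} (\<lambda>t. primitive t)"
  by (rule indefinite_integral_continuous_1) (rule set_borel_integral_eq_integral(1)[OF integrable])

lemma gram_continuous:
  "continuous_on ({\<mu>..b} \<times> {\<mu>..b})
    (\<lambda>(t, \<sigma>). transpose (primitive t - primitive \<sigma>) ** (primitive t - primitive \<sigma>))"
  unfolding split_beta
  by (intro continuous_on_gram_matrix continuous_on_diff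
      continuous_on_compose2[OF primitive_continuous continuous_on_fst[OF continuous_on_id]]
      continuous_on_compose2[OF primitive_continuous continuous_on_snd[OF continuous_on_id]]) auto

text \<open>Only the interior of the square matters, so the integrand may be given by another formula on the
  boundary.\<close>

lemma interval_double_integral_eq:
  fixes h :: "real \<Rightarrow> real \<Rightarrow> 'a::euclidean_space"
  assumes cont: "continuous_on ({\<mu>..b} \<times> {\<mu>..b}) (\<lambda>(t, \<sigma>). h t \<sigma>)"
    and eq: "\<And>t \<sigma>. t \<in> {\<mu><..<b} \<Longrightarrow> \<sigma> \<in> {\<mu><..<b} \<Longrightarrow> h' t \<sigma> = h t \<sigma>"
  shows "(LBINT t=\<mu>..b. (LBINT \<sigma>=\<mu>..b. h' t \<sigma>)) = integral {\<mu>..b} (\<lambda>t. integral {\<mu>..b} (h t))"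
proof -
  have inner: "(LBINT \<sigma>=\<mu>..b. h' t \<sigma>) = integral {\<mu>..b} (h t)" if "t \<in> {\<mu><..<b}" for t
  proof -
    have "continuous_on {\<mu>..b} (h t)"
      using that by (intro continuous_on_slice[OF cont]) auto
    then have "(LBINT \<sigma>=\<mu>..b. h t \<sigma>) = integral {\<mu>..b} (h t)"
      by (intro interval_integral_eq_integral le borel_integrable_atLeastAtMost')
    moreover have "(LBINT \<sigma>=\<mu>..b. h' t \<sigma>) = (LBINT \<sigma>=\<mu>..b. h t \<sigma>)"
      using le that by (intro interval_lebesgue_integral_cong) (auto simp: eq)
    ultimately show ?thesis by simp
  qed
  have "continuous_on {\<mu>..b} (\<lambda>t. integral (cbox \<mu> b) (h t))"
    using cont by (intro integral_continuous_on_param) (simp add: cbox_interval)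
  then have "(LBINT t=\<mu>..b. integral {\<mu>..b} (h t)) = integral {\<mu>..b} (\<lambda>t. integral {\<mu>..b} (h t))"
    unfolding cbox_interval by (intro interval_integral_eq_integral le borel_integrable_atLeastAtMost')
  moreover have "(LBINT t=\<mu>..b. (LBINT \<sigma>=\<mu>..b. h' t \<sigma>)) = (LBINT t=\<mu>..b. integral {\<mu>..b} (h t))"
    using le by (intro interval_lebesgue_integral_cong) (auto simp: inner)
  ultimately show ?thesis by simp
qed

lemma bounded_linear_double_integral:
  fixes h :: "real \<Rightarrow> real \<Rightarrow> 'a::euclidean_space" and l :: "'a \<Rightarrow> 'b::euclidean_space"
  assumes cont: "continuous_on ({\<mu>..b} \<times> {\<mu>..b}) (\<lambda>(t, \<sigma>). h t \<sigma>)" and l: "bounded_linear l"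
  shows "l (integral {\<mu>..b} (\<lambda>t. integral {\<mu>..b} (h t))) =
    integral {\<mu>..b} (\<lambda>t. integral {\<mu>..b} (\<lambda>\<sigma>. l (h t \<sigma>)))"
proof -
  have "continuous_on {\<mu>..b} (\<lambda>t. integral (cbox \<mu> b) (h t))"
    using cont by (intro integral_continuous_on_param) (simp add: cbox_interval)
  then have "l (integral {\<mu>..b} (\<lambda>t. integral {\<mu>..b} (h t))) =
      integral {\<mu>..b} (\<lambda>t. l (integral {\<mu>..b} (h t)))"
    using integral_linear[OF _ l, of "\<lambda>t. integral {\<mu>..b} (h t)" "{\<mu>..b}"]
    by (simp add: o_def integrable_continuous_real)
  also have "\<dots> = integral {\<mu>..b} (\<lambda>t. integral {\<mu>..b} (\<lambda>\<sigma>. l (h t \<sigma>)))"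
  proof (rule integral_cong)
    fix t assume "t \<in> {\<mu>..b}"
    then have "continuous_on {\<mu>..b} (h t)"
      by (rule continuous_on_slice[OF cont])
    then show "l (integral {\<mu>..b} (h t)) = integral {\<mu>..b} (\<lambda>\<sigma>. l (h t \<sigma>))"
      using integral_linear[OF _ l, of "h t" "{\<mu>..b}"] by (simp add: o_def integrable_continuous_real)
  qed
  finally show ?thesis .
qed

lemma G_mat_eq_integral:
  "G_mat g x u b \<mu> = integral {\<mu>..b} (\<lambda>t. integral {\<mu>..b} (\<lambda>\<sigma>.
     transpose (primitive t - primitive \<sigma>) ** (primitive t - primitive \<sigma>)))"
  unfolding G_mat_def
  by (rule interval_double_integral_eq[OF gram_continuous]) (simp add: q_fun_eq_primitive_diff)

text \<open>The relation \<open>p = q \<theta>\<close> turns the integrand \<open>q' p\<close> of \<open>Z\<close> into \<open>(q' q) \<theta>\<close>, and the multiplication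
  by \<open>\<theta>\<close> moves out of both integrals.\<close>

lemma Z_vec_eq_G_mat_mult:
  assumes p: "\<And>t \<sigma>. t \<in> {\<mu>..b} \<Longrightarrow> \<sigma> \<in> {\<mu>..b} \<Longrightarrow> p_fun f x u t \<sigma> = q_fun g x u t \<sigma> *v \<theta>"
  shows "Z_vec f g x u b \<mu> = G_mat g x u b \<mu> *v \<theta>"
proof -
  note l = bounded_linear_matrix_vector_mult_left[of \<theta>]
  have "Z_vec f g x u b \<mu> = integral {\<mu>..b} (\<lambda>t. integral {\<mu>..b} (\<lambda>\<sigma>.
     (transpose (primitive t - primitive \<sigma>) ** (primitive t - primitive \<sigma>)) *v \<theta>))"
    unfolding Z_vec_def
  proof (rule interval_double_integral_eq)
    show "continuous_on ({\<mu>..b} \<times> {\<mu>..b}) (\<lambda>(t, \<sigma>).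
        (transpose (primitive t - primitive \<sigma>) ** (primitive t - primitive \<sigma>)) *v \<theta>)"
      using bounded_linear.continuous_on[OF l gram_continuous] by (simp add: split_beta)
  qed (simp add: p q_fun_eq_primitive_diff matrix_vector_mul_assoc)
  also have "\<dots> = G_mat g x u b \<mu> *v \<theta>"
    unfolding G_mat_eq_integral by (rule bounded_linear_double_integral[OF gram_continuous l, symmetric])
  finally show ?thesis .
qed

text \<open>The quadratic form \<open>v \<bullet> G v\<close> is the double integral of the continuous function \<open>\<bar>q(t,\<sigma>) v\<bar>\<^sup>2\<close>, so it
  vanishes only if \<open>q(t,\<sigma>) v = 0\<close> on the whole square; at \<open>\<sigma> = \<mu>\<close> this is the claim.\<close>

lemma G_mat_kernel_imp_primitive_kernel:
  assumes "\<mu> < b" and kernel: "G_mat g x u b \<mu> *v v = 0" and t: "t \<in> {\<mu>..b}"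
  shows "primitive t *v v = 0"
proof -
  let ?D = "\<lambda>t \<sigma>. primitive t - primitive \<sigma>"
  have l: "bounded_linear (\<lambda>A::real^'l^'l. v \<bullet> (A *v v))"
    by (rule bounded_linear_compose[OF bounded_linear_inner_right bounded_linear_matrix_vector_mult_left])
  have cont: "continuous_on ({\<mu>..b} \<times> {\<mu>..b}) (\<lambda>(t, \<sigma>). (norm (?D t \<sigma> *v v))\<^sup>2)"
    using bounded_linear.continuous_on[OF l gram_continuous] by (simp add: split_beta inner_gram_matrix)
  then have cont_outer: "continuous_on {\<mu>..b} (\<lambda>t. integral (cbox \<mu> b) (\<lambda>\<sigma>. (norm (?D t \<sigma> *v v))\<^sup>2))"
    by (intro integral_continuous_on_param) (simp add: cbox_interval)
  have cont_inner: "continuous_on {\<mu>..b} (\<lambda>\<sigma>. (norm (?D t \<sigma> *v v))\<^sup>2)" if "t \<in> {\<mu>..b}" for t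
    using continuous_on_slice[OF cont that] .
  then have nonneg: "0 \<le> integral {\<mu>..b} (\<lambda>\<sigma>. (norm (?D t \<sigma> *v v))\<^sup>2)" if "t \<in> {\<mu>..b}" for t
    using that by (intro integral_nonneg integrable_continuous_real) auto
  have "integral {\<mu>..b} (\<lambda>t. integral {\<mu>..b} (\<lambda>\<sigma>. (norm (?D t \<sigma> *v v))\<^sup>2)) = v \<bullet> (G_mat g x u b \<mu> *v v)"
    using bounded_linear_double_integral[OF gram_continuous l]
    by (simp add: G_mat_eq_integral inner_gram_matrix)
  then have "integral {\<mu>..b} (\<lambda>t. integral {\<mu>..b} (\<lambda>\<sigma>. (norm (?D t \<sigma> *v v))\<^sup>2)) = 0"
    by (simp add: kernel)
  then have "\<forall>t\<in>{\<mu>..b}. integral {\<mu>..b} (\<lambda>\<sigma>. (norm (?D t \<sigma> *v v))\<^sup>2) = 0"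
    using cont_outer \<open>\<mu> < b\<close>
    using nonneg by (subst (asm) integral_eq_0_iff) (auto simp: cbox_interval)
  then have "integral {\<mu>..b} (\<lambda>\<sigma>. (norm (?D t \<sigma> *v v))\<^sup>2) = 0"
    using t by blast
  then have "\<forall>\<sigma>\<in>{\<mu>..b}. (norm (?D t \<sigma> *v v))\<^sup>2 = 0"
    using \<open>\<mu> < b\<close> cont_inner[OF t] by (subst (asm) integral_eq_0_iff) auto
  then have "(norm (?D t \<mu> *v v))\<^sup>2 = 0"
    by (rule bspec) (use le in auto)
  then show ?thesis
    by simp
qed

text \<open>Differentiate the vanishing function \<open>t \<mapsto> q(t,\<mu>) v\<close>.\<close>

lemma G_mat_kernel_imp_regressor_kernel:
  assumes "\<mu> < b" and kernel: "G_mat g x u b \<mu> *v v = 0"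
    and t: "t \<in> {\<mu><..<b}" and cont: "isCont (\<lambda>s. g (x s, u s)) t"
  shows "g (x t, u t) *v v = 0"
proof -
  have "((\<lambda>t. primitive t) has_vector_derivative g (x t, u t)) (at t within {\<mu>..b} - {})"
  proof (rule integral_has_vector_derivative_continuous_at)
    show "(\<lambda>s. g (x s, u s)) integrable_on {\<mu>..b}"
      by (rule set_borel_integral_eq_integral(1)[OF integrable])
    show "continuous (at t within {\<mu>..b} - {}) (\<lambda>s. g (x s, u s))"
      by (rule continuous_at_imp_continuous_at_within[OF cont])
  qed (use t in auto)
  then have "((\<lambda>t. primitive t) has_vector_derivative g (x t, u t)) (at t)"
    using t by (simp add: at_within_Icc_at)
  then have "((\<lambda>t. primitive t *v v) has_vector_derivative g (x t, u t) *v v) (at t)"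
    by (rule bounded_linear.has_vector_derivative[OF bounded_linear_matrix_vector_mult_left])
  moreover have "((\<lambda>t. primitive t *v v) has_vector_derivative 0) (at t)"
  proof (rule has_vector_derivative_transform_within_open[where S = "{\<mu><..<b}" and f = "\<lambda>_. 0"])
    show "0 = primitive s *v v" if "s \<in> {\<mu><..<b}" for s
      using G_mat_kernel_imp_primitive_kernel[OF assms(1,2), of s] that by simp
  qed (use t in auto)
  ultimately show ?thesis
    by (rule vector_derivative_unique_at)
qed

text \<open>Integrate the plant equation. The exceptional set \<open>S\<close> is there for the event times, where \<open>x\<close> has a
  corner.\<close>

lemma p_fun_eq_q_fun_mult:
  assumes f: "set_integrable lborel {\<mu>..b} (\<lambda>s. f (x s, u s))"
    and x: "continuous_on {\<mu>..b} x" and "finite S"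
    and der: "\<And>t. t \<in> {\<mu><..<b} - S \<Longrightarrow>
      (x has_vector_derivative f (x t, u t) + g (x t, u t) *v \<theta>) (at t)"
    and t: "t \<in> {\<mu>..b}" and \<sigma>: "\<sigma> \<in> {\<mu>..b}"
  shows "p_fun f x u t \<sigma> = q_fun g x u t \<sigma> *v \<theta>"
proof -
  note l = bounded_linear_matrix_vector_mult_left[of \<theta>]
  have *: "x t - x \<mu> = integral {\<mu>..t} (\<lambda>s. f (x s, u s)) + primitive t *v \<theta>" if t: "t \<in> {\<mu>..b}" for t
  proof -
    have "((\<lambda>s. f (x s, u s) + g (x s, u s) *v \<theta>) has_integral x t - x \<mu>) {\<mu>..t}"
    proof (rule fundamental_theorem_of_calculus_interior_strong[OF \<open>finite S\<close>])
      show "continuous_on {\<mu>..t} x"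
        using t by (intro continuous_on_subset[OF x]) auto
    qed (use t der in auto)
    moreover have "(\<lambda>s. f (x s, u s)) integrable_on {\<mu>..t}" "(\<lambda>s. g (x s, u s)) integrable_on {\<mu>..t}"
      using t integrable_on_subinterval[OF set_borel_integral_eq_integral(1)[OF f], of \<mu> t]
        integrable_on_subinterval[OF set_borel_integral_eq_integral(1)[OF integrable], of \<mu> t] by auto
    then have "((\<lambda>s. f (x s, u s) + g (x s, u s) *v \<theta>) has_integral
        integral {\<mu>..t} (\<lambda>s. f (x s, u s)) + primitive t *v \<theta>) {\<mu>..t}"
      using has_integral_linear[OF integrable_integral l, of "\<lambda>s. g (x s, u s)" "{\<mu>..t}"]
      by (intro has_integral_add integrable_integral) (simp_all add: o_def)
    ultimately show ?thesis
      by (rule has_integral_unique)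
  qed
  show ?thesis
    using *[OF t] *[OF \<sigma>]
    by (simp add: p_fun_def interval_integral_eq_integral_diff[OF f t \<sigma>] q_fun_eq_primitive_diff[OF t \<sigma>]
        matrix_vector_mult_diff_rdistrib algebra_simps)
qed

end

section \<open>Trajectories over finitely many sampling intervals\<close>

text \<open>For a nonempty closed convex constraint set, being the unique minimizer means being the nearest
  point; this gives access to the nonexpansiveness of the projection.\<close>

lemma unique_arg_min_iff_closest_point:
  fixes S :: "'a::euclidean_space set"
  assumes S: "convex S" "closed S" "S \<noteq> {}"
  shows "(\<forall>\<eta>. is_arg_min (\<lambda>\<zeta>. (norm (\<zeta> - c))\<^sup>2) (\<lambda>\<zeta>. \<zeta> \<in> S) \<eta> \<longleftrightarrow> \<eta> = y) \<longleftrightarrow> y = closest_point S c"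
proof -
  have "is_arg_min (\<lambda>\<zeta>. (norm (\<zeta> - c))\<^sup>2) (\<lambda>\<zeta>. \<zeta> \<in> S) \<eta> \<longleftrightarrow> \<eta> \<in> S \<and> (\<forall>\<zeta>\<in>S. dist c \<eta> \<le> dist c \<zeta>)" for \<eta>
    by (auto simp: is_arg_min_def dist_norm norm_minus_commute not_less power_mono_iff)
  also have "\<dots> \<eta> \<longleftrightarrow> \<eta> = closest_point S c" for \<eta>
    using closest_point_unique[OF S(1,2)] closest_point_exists[OF S(2,3)] by blast
  finally show ?thesis by auto
qed

lemma q_fun_cong:
  assumes "\<And>s. s \<in> {\<mu><..<b} \<Longrightarrow> x s = x' s \<and> u s = u' s" "t \<in> {\<mu><..<b}" "\<sigma> \<in> {\<mu><..<b}"
  shows "q_fun g x u t \<sigma> = q_fun g x' u' t \<sigma>"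
  unfolding q_fun_def
  by (rule interval_integral_cong) (use assms in \<open>auto simp: einterval_eq min_def max_def split: if_splits\<close>)

lemma p_fun_cong:
  assumes "\<And>s. s \<in> {\<mu><..<b} \<Longrightarrow> x s = x' s \<and> u s = u' s" "t \<in> {\<mu><..<b}" "\<sigma> \<in> {\<mu><..<b}"
  shows "p_fun f x u t \<sigma> = p_fun f x' u' t \<sigma>"
proof -
  have "(LBINT s=\<sigma>..t. f (x s, u s)) = (LBINT s=\<sigma>..t. f (x' s, u' s))"
    by (rule interval_integral_cong) (use assms in \<open>auto simp: einterval_eq min_def max_def split: if_splits\<close>)
  then show ?thesis
    using assms by (simp add: p_fun_def)
qed

lemma G_mat_cong:
  assumes "\<mu> \<le> b" and eq: "\<And>s. s \<in> {\<mu><..<b} \<Longrightarrow> x s = x' s \<and> u s = u' s"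
  shows "G_mat g x u b \<mu> = G_mat g x' u' b \<mu>"
  unfolding G_mat_def
  using \<open>\<mu> \<le> b\<close> q_fun_cong[of \<mu> b x x' u u' _ _ g, OF eq]
  by (intro interval_integral_cong) (auto simp: einterval_eq min_def max_def)

lemma Z_vec_cong:
  assumes "\<mu> \<le> b" and eq: "\<And>s. s \<in> {\<mu><..<b} \<Longrightarrow> x s = x' s \<and> u s = u' s"
  shows "Z_vec f g x u b \<mu> = Z_vec f g x' u' b \<mu>"
  unfolding Z_vec_def
  using \<open>\<mu> \<le> b\<close> q_fun_cong[of \<mu> b x x' u u' _ _ g, OF eq] p_fun_cong[of \<mu> b x x' u u' _ _ f, OF eq]
  by (intro interval_integral_cong) (auto simp: einterval_eq min_def max_def)

text \<open>The latest event \<open>\<tau>\<^sub>i\<close> qualifies because the last interval is no longer than \<open>T \<le> N' T\<close>, so the minimum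
  is taken over a nonempty set.\<close>

lemma window_start_in:
  assumes "N' > 0" "T > 0" "\<tau> (Suc i) \<le> \<tau> i + T"
  obtains m where "m \<le> i" "window_start \<tau> T N' i = \<tau> m"
proof -
  define S where "S = {\<tau> j | j. j \<le> i \<and> \<tau> j \<ge> \<tau> (Suc i) - real N' * T}"
  have "T \<le> real N' * T"
    using assms mult_right_mono[of 1 "real N'" T] by simp
  then have "\<tau> (Suc i) - real N' * T \<le> \<tau> i"
    using assms by linarith
  then have "\<tau> i \<in> S"
    by (auto simp: S_def)
  moreover have "finite S"
    by (rule finite_subset[of _ "\<tau> ` {..i}"]) (auto simp: S_def)
  ultimately have "Min S \<in> S"
    by (intro Min_in) auto
  then show thesis
    using that by (auto simp: S_def window_start_def)
qed

lemma bracketing_interval: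
  fixes \<tau> :: "nat \<Rightarrow> 'a::linorder"
  assumes "\<tau> 0 \<le> t" "t < \<tau> n"
  obtains i where "i < n" "\<tau> i \<le> t" "t < \<tau> (Suc i)"
  using assms(2)
proof (induction n arbitrary: thesis)
  case 0
  then show ?case using assms(1) by simp
next
  case (Suc n)
  then show ?case
    by (metis less_Suc_eq not_le)
qed

context triggered_loop
begin

text \<open>The clauses of a hybrid solution for one interval, separated so that a solution can be built and
  studied interval by interval: the motion on \<open>[\<tau>\<^sub>i, \<tau>\<^sub>i\<^sub>+\<^sub>1)\<close>, the choice of \<open>\<tau>\<^sub>i\<^sub>+\<^sub>1\<close>, the solution set of
  the normal equations at \<open>\<tau>\<^sub>i\<^sub>+\<^sub>1\<close>, and the update.\<close>

definition flow :: "real^'l \<Rightarrow> (real \<Rightarrow> real^'n) \<Rightarrow> (real \<Rightarrow> real^'m) \<Rightarrow> (real \<Rightarrow> real^'l) \<Rightarrow> (nat \<Rightarrow> real) \<Rightarrow> nat \<Rightarrow> bool"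
  where "flow \<theta> x u \<theta>h \<tau> i \<longleftrightarrow>
    (\<forall>t\<in>{\<tau> i..<\<tau> (Suc i)}. u t = k (\<theta>h (\<tau> i), x t) \<and> \<theta>h t = \<theta>h (\<tau> i) \<and>
       (x has_vector_derivative f (x t, u t) + g (x t, u t) *v \<theta>) (at t within {\<tau> i..<\<tau> (Suc i)}))"

definition sampling :: "real^'l \<Rightarrow> (real \<Rightarrow> real^'n) \<Rightarrow> (real \<Rightarrow> real^'l) \<Rightarrow> (nat \<Rightarrow> real) \<Rightarrow> nat \<Rightarrow> bool"
  where "sampling \<theta> x \<theta>h \<tau> i \<longleftrightarrow> ereal (\<tau> (Suc i)) =
    min (ereal (\<tau> i + T)) (trigger_time f g k V Q a T \<theta> (\<theta>h (\<tau> i)) (\<tau> i) (x (\<tau> i)))"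

definition consistent :: "nat \<Rightarrow> (real \<Rightarrow> real^'n) \<Rightarrow> (real \<Rightarrow> real^'m) \<Rightarrow> (nat \<Rightarrow> real) \<Rightarrow> nat \<Rightarrow> (real^'l) set"
  where "consistent N' x u \<tau> i = {\<zeta>. Z_vec f g x u (\<tau> (Suc i)) (window_start \<tau> T N' i) =
    G_mat g x u (\<tau> (Suc i)) (window_start \<tau> T N' i) *v \<zeta>}"

definition update :: "nat \<Rightarrow> (real \<Rightarrow> real^'n) \<Rightarrow> (real \<Rightarrow> real^'m) \<Rightarrow> (real \<Rightarrow> real^'l) \<Rightarrow> (nat \<Rightarrow> real) \<Rightarrow> nat \<Rightarrow> bool"
  where "update N' x u \<theta>h \<tau> i \<longleftrightarrow> (\<forall>\<eta>. is_arg_min (\<lambda>\<zeta>. (norm (\<zeta> - \<theta>h (\<tau> i)))\<^sup>2)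
     (\<lambda>\<zeta>. \<zeta> \<in> consistent N' x u \<tau> i) \<eta> \<longleftrightarrow> \<eta> = \<theta>h (\<tau> (Suc i)))"

text \<open>The motion over the first \<open>n\<close> intervals, with no condition on how the estimates or the event times
  are chosen. This is all that the normal equations depend on.\<close>

definition run :: "real^'l \<Rightarrow> (real \<Rightarrow> real^'n) \<Rightarrow> (real \<Rightarrow> real^'m) \<Rightarrow> (real \<Rightarrow> real^'l) \<Rightarrow> (nat \<Rightarrow> real) \<Rightarrow> nat \<Rightarrow> bool"
  where "run \<theta> x u \<theta>h \<tau> n \<longleftrightarrow> \<tau> 0 = 0 \<and> continuous_on {0..\<tau> n} x \<and>
    (\<forall>i<n. \<tau> i < \<tau> (Suc i) \<and> flow \<theta> x u \<theta>h \<tau> i)"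

lemma hybrid_solution_iff:
  "hybrid_solution f g k V Q a T N' \<theta> x0 \<theta>h0 x u \<theta>h \<tau> \<longleftrightarrow>
     x 0 = x0 \<and> \<theta>h 0 = \<theta>h0 \<and> \<tau> 0 = 0 \<and> strict_mono \<tau> \<and> continuous_on (\<Union>i. {\<tau> i..<\<tau> (Suc i)}) x \<and>
     (\<forall>i. flow \<theta> x u \<theta>h \<tau> i \<and> sampling \<theta> x \<theta>h \<tau> i \<and> update N' x u \<theta>h \<tau> i)"
  by (simp add: hybrid_solution_def flow_def sampling_def update_def consistent_def Let_def)

lemma flowD:
  assumes "flow \<theta> x u \<theta>h \<tau> i" "\<tau> i \<le> t" "t < \<tau> (Suc i)"
  shows "u t = k (\<theta>h (\<tau> i), x t)" "\<theta>h t = \<theta>h (\<tau> i)"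
    "(x has_vector_derivative f (x t, u t) + g (x t, u t) *v \<theta>) (at t within {\<tau> i..<\<tau> (Suc i)})"
  using assms(1)[unfolded flow_def, rule_format, of t] assms(2,3) by auto

lemma sampling_le: "sampling \<theta> x \<theta>h \<tau> i \<Longrightarrow> \<tau> (Suc i) \<le> \<tau> i + T"
  unfolding sampling_def by (metis ereal_less_eq(3) min.cobounded1)

lemma consistent_convex_closed: "convex (consistent N' x u \<tau> i)" "closed (consistent N' x u \<tau> i)"
proof -
  let ?Z = "Z_vec f g x u (\<tau> (Suc i)) (window_start \<tau> T N' i)"
  let ?G = "G_mat g x u (\<tau> (Suc i)) (window_start \<tau> T N' i)"
  have eq: "consistent N' x u \<tau> i = ((*v) ?G) -` {?Z}"
    by (auto simp: consistent_def)
  show "convex (consistent N' x u \<tau> i)"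
    unfolding eq by (intro convex_linear_vimage) auto
  show "closed (consistent N' x u \<tau> i)"
    unfolding eq by (intro continuous_closed_vimage) (auto intro: linear_continuous_at matrix_vector_mul_bounded_linear)
qed

lemma run_mono:
  assumes "run \<theta> x u \<theta>h \<tau> n" "i \<le> j" "j \<le> n"
  shows "\<tau> i \<le> \<tau> j"
  using assms(2,3)
proof (induction j rule: dec_induct)
  case (step j)
  then show ?case using assms(1) unfolding run_def by (smt (verit) Suc_le_lessD less_imp_le_nat)
qed simp

lemma run_nonneg: "run \<theta> x u \<theta>h \<tau> n \<Longrightarrow> i \<le> n \<Longrightarrow> 0 \<le> \<tau> i"
  using run_mono[of \<theta> x u \<theta>h \<tau> n 0 i] by (simp add: run_def)

lemma run_prefix:
  assumes "run \<theta> x u \<theta>h \<tau> n" "m \<le> n"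
  shows "run \<theta> x u \<theta>h \<tau> m"
  using assms run_mono[OF assms order_refl]
  by (auto simp: run_def elim: continuous_on_subset)

text \<open>On each half-open interval the integrand agrees with a function that is continuous up to the end,
  and finitely many intervals suffice.\<close>

lemma run_integrable:
  fixes h :: "(real^'n) \<times> (real^'m) \<Rightarrow> 'b::euclidean_space"
  assumes run: "run \<theta> x u \<theta>h \<tau> n" and h: "continuous_on UNIV h"
  shows "set_integrable lborel {0..\<tau> n} (\<lambda>s. h (x s, u s))"
proof -
  have "set_integrable lborel {0..<\<tau> i} (\<lambda>s. h (x s, u s))" if "i \<le> n" for i
    using that
  proof (induction i)
    case 0
    then show ?case using run by (simp add: run_def)
  next
    case (Suc i)
    have \<tau>: "\<tau> i < \<tau> (Suc i)" "0 \<le> \<tau> i" and flow: "flow \<theta> x u \<theta>h \<tau> i"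
      using run Suc.prems run_nonneg[OF run, of i] by (auto simp: run_def)
    have "{\<tau> i..\<tau> (Suc i)} \<subseteq> {0..\<tau> n}"
      using \<tau> run_mono[OF run Suc.prems order_refl] by auto
    then have x: "continuous_on {\<tau> i..\<tau> (Suc i)} x"
      using run by (auto simp: run_def elim: continuous_on_subset)
    have "continuous_on {\<tau> i..\<tau> (Suc i)} (\<lambda>s. h (x s, k (\<theta>h (\<tau> i), x s)))"
      by (intro continuous_on_compose2[OF h] continuous_on_Pair x
          continuous_on_compose2[OF lipschitz_on_balls_imp_continuous_on[OF lipschitz(3)]] continuous_on_const) auto
    then have "set_integrable lborel {\<tau> i..\<tau> (Suc i)} (\<lambda>s. h (x s, k (\<theta>h (\<tau> i), x s)))"
      by (rule borel_integrable_atLeastAtMost')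
    then have "set_integrable lborel {\<tau> i..<\<tau> (Suc i)} (\<lambda>s. h (x s, k (\<theta>h (\<tau> i), x s)))"
      by (rule set_integrable_subset) auto
    then have "set_integrable lborel {\<tau> i..<\<tau> (Suc i)} (\<lambda>s. h (x s, u s))"
      by (subst set_integrable_cong[OF refl refl, of _ _ "\<lambda>s. h (x s, k (\<theta>h (\<tau> i), x s))"])
        (auto simp: flowD(1)[OF flow])
    moreover have "set_integrable lborel {0..<\<tau> i} (\<lambda>s. h (x s, u s))"
      using Suc by simp
    moreover have "{0..<\<tau> (Suc i)} = {0..<\<tau> i} \<union> {\<tau> i..<\<tau> (Suc i)}"
      using \<tau> by auto
    ultimately show ?case
      by (simp add: set_integrable_Un)
  qed
  then have "set_integrable lborel {0..<\<tau> n} (\<lambda>s. h (x s, u s))"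
    by simp
  then show ?thesis
    by (rule set_integrable_discrete_difference[where X = "{\<tau> n}", THEN iffD1, rotated -1])
      (use run_nonneg[OF run, of n] in auto)
qed

lemma run_derivative:
  assumes run: "run \<theta> x u \<theta>h \<tau> n" and t: "t \<in> {0<..<\<tau> n} - \<tau> ` {..n}"
  shows "(x has_vector_derivative f (x t, u t) + g (x t, u t) *v \<theta>) (at t)"
proof -
  obtain i where i: "i < n" "\<tau> i \<le> t" "t < \<tau> (Suc i)"
    using bracketing_interval[of \<tau> t n] run t by (auto simp: run_def)
  then have "t \<in> {\<tau> i<..<\<tau> (Suc i)}"
    using t by (auto simp: le_less)
  moreover have "(x has_vector_derivative f (x t, u t) + g (x t, u t) *v \<theta>) (at t within {\<tau> i..<\<tau> (Suc i)})"
    using run i flowD(3) by (auto simp: run_def)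
  then have "(x has_vector_derivative f (x t, u t) + g (x t, u t) *v \<theta>) (at t within {\<tau> i<..<\<tau> (Suc i)})"
    by (rule has_vector_derivative_within_subset) auto
  ultimately show ?thesis
    by (simp add: at_within_open[OF _ open_greaterThanLessThan])
qed

lemma run_window_integrable:
  fixes h :: "(real^'n) \<times> (real^'m) \<Rightarrow> 'b::euclidean_space"
  assumes "run \<theta> x u \<theta>h \<tau> n" "m \<le> n" "continuous_on UNIV h"
  shows "set_integrable lborel {\<tau> m..\<tau> n} (\<lambda>s. h (x s, u s))"
  by (rule set_integrable_subset[OF run_integrable[OF assms(1,3)]]) (use run_nonneg[OF assms(1,2)] in auto)

lemma true_parameter_consistent:
  assumes run: "run \<theta> x u \<theta>h \<tau> (Suc i)" and m: "m \<le> i" "window_start \<tau> T N' i = \<tau> m"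
  shows "\<theta> \<in> consistent N' x u \<tau> i"
proof -
  have le: "\<tau> m \<le> \<tau> (Suc i)" "0 \<le> \<tau> m"
    using run_mono[OF run, of m] run_nonneg[OF run, of m] m by auto
  note int = run_window_integrable[OF run le_SucI[OF m(1)]]
  have int_g: "set_integrable lborel {\<tau> m..\<tau> (Suc i)} (\<lambda>s. g (x s, u s))"
    and int_f: "set_integrable lborel {\<tau> m..\<tau> (Suc i)} (\<lambda>s. f (x s, u s))"
    by (intro int lipschitz_on_balls_imp_continuous_on lipschitz)+
  have "p_fun f x u t \<sigma> = q_fun g x u t \<sigma> *v \<theta>"
    if "t \<in> {\<tau> m..\<tau> (Suc i)}" "\<sigma> \<in> {\<tau> m..\<tau> (Suc i)}" for t \<sigma>
  proof (rule p_fun_eq_q_fun_mult[OF le(1) int_g int_f _ _ _ that])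
    show "continuous_on {\<tau> m..\<tau> (Suc i)} x"
      using run le by (auto simp: run_def elim: continuous_on_subset)
    show "finite (\<tau> ` {..Suc i})"
      by simp
    show "(x has_vector_derivative f (x t, u t) + g (x t, u t) *v \<theta>) (at t)"
      if "t \<in> {\<tau> m<..<\<tau> (Suc i)} - \<tau> ` {..Suc i}" for t
      using that le by (intro run_derivative[OF run]) auto
  qed
  from Z_vec_eq_G_mat_mult[OF le(1) int_g this] show ?thesis
    by (simp add: consistent_def m(2))
qed

text \<open>Two solutions of the normal equations differ by an element of the kernel of \<open>G\<close>, which the regressor
  annihilates wherever the control is continuous, that is, inside every interval of the window.
  With the estimate of the interval inserted, the regressor is continuous up to both end points,
  so the relation extends to the closed interval, as assumption (iii) requires.\<close>

lemma consistent_imp_regressor_kernel: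
  assumes run: "run \<theta> x u \<theta>h \<tau> (Suc i)" and m: "m \<le> j" "window_start \<tau> T N' i = \<tau> m" and j: "j \<le> i"
    and "\<zeta> \<in> consistent N' x u \<tau> i" and t: "t \<in> {\<tau> j..\<tau> (Suc j)}"
  shows "g (x t, k (\<theta>h (\<tau> j), x t)) *v (\<zeta> - \<theta>) = 0"
proof -
  have le: "0 \<le> \<tau> m" "\<tau> m \<le> \<tau> j" "\<tau> j < \<tau> (Suc j)" "\<tau> (Suc j) \<le> \<tau> (Suc i)"
    and flow: "flow \<theta> x u \<theta>h \<tau> j"
    using run_mono[OF run, of m j] run_mono[OF run, of "Suc j" "Suc i"] run_nonneg[OF run, of m] m j run
    by (auto simp: run_def)
  have int_g: "set_integrable lborel {\<tau> m..\<tau> (Suc i)} (\<lambda>s. g (x s, u s))"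
    by (intro run_window_integrable[OF run] lipschitz_on_balls_imp_continuous_on lipschitz) (use m j in auto)
  have "\<theta> \<in> consistent N' x u \<tau> i"
    using true_parameter_consistent[OF run order_trans[OF m(1) j] m(2)] .
  then have kernel: "G_mat g x u (\<tau> (Suc i)) (\<tau> m) *v (\<zeta> - \<theta>) = 0"
    using \<open>\<zeta> \<in> consistent N' x u \<tau> i\<close> m(2)
    by (simp add: consistent_def matrix_vector_mult_diff_distrib)
  have x: "continuous_on {\<tau> j..\<tau> (Suc j)} x"
    using run le by (auto simp: run_def elim: continuous_on_subset)
  have cont: "continuous_on {\<tau> j..\<tau> (Suc j)} (\<lambda>t. g (x t, k (\<theta>h (\<tau> j), x t)))"
    by (intro continuous_on_compose2[OF lipschitz_on_balls_imp_continuous_on[OF lipschitz(2)]] continuous_on_Pair x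
        continuous_on_compose2[OF lipschitz_on_balls_imp_continuous_on[OF lipschitz(3)]] continuous_on_const) auto
  have u: "u s = k (\<theta>h (\<tau> j), x s)" if "s \<in> {\<tau> j<..<\<tau> (Suc j)}" for s
    using flowD(1)[OF flow] that by simp
  have "continuous_on {\<tau> j<..<\<tau> (Suc j)} (\<lambda>s. g (x s, k (\<theta>h (\<tau> j), x s)))"
    by (rule continuous_on_subset[OF cont]) auto
  then have "continuous_on {\<tau> j<..<\<tau> (Suc j)} (\<lambda>s. g (x s, u s))"
    by (rule continuous_on_eq) (simp add: u)
  then have "isCont (\<lambda>s. g (x s, u s)) s" if "s \<in> {\<tau> j<..<\<tau> (Suc j)}" for s
    using that by (simp add: continuous_on_eq_continuous_at)
  then have "g (x s, u s) *v (\<zeta> - \<theta>) = 0" if "s \<in> {\<tau> j<..<\<tau> (Suc j)}" for s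
    using that le by (intro G_mat_kernel_imp_regressor_kernel[OF _ int_g _ kernel]) auto
  then have zero: "g (x s, k (\<theta>h (\<tau> j), x s)) *v (\<zeta> - \<theta>) = 0" if "s \<in> {\<tau> j<..<\<tau> (Suc j)}" for s
    using that u by simp
  have closure: "closure {\<tau> j<..<\<tau> (Suc j)} = {\<tau> j..\<tau> (Suc j)}"
    using le by (intro closure_greaterThanLessThan)
  show ?thesis
  proof (rule continuous_constant_on_closure[of "{\<tau> j<..<\<tau> (Suc j)}"])
    show "continuous_on (closure {\<tau> j<..<\<tau> (Suc j)}) (\<lambda>t. g (x t, k (\<theta>h (\<tau> j), x t)) *v (\<zeta> - \<theta>))"
      unfolding closure by (rule bounded_linear.continuous_on[OF bounded_linear_matrix_vector_mult_left cont])
  qed (use zero t closure in auto)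
qed

lemma update_iff_closest_point:
  assumes "\<theta> \<in> consistent N' x u \<tau> i"
  shows "update N' x u \<theta>h \<tau> i \<longleftrightarrow> \<theta>h (\<tau> (Suc i)) = closest_point (consistent N' x u \<tau> i) (\<theta>h (\<tau> i))"
  unfolding update_def
  using assms by (intro unique_arg_min_iff_closest_point consistent_convex_closed) auto

text \<open>The projection onto the solution set fixes \<open>\<theta>\<close> and is 1-Lipschitz.\<close>

lemma update_nonexpansive:
  assumes "\<theta> \<in> consistent N' x u \<tau> i" "update N' x u \<theta>h \<tau> i"
  shows "dist \<theta> (\<theta>h (\<tau> (Suc i))) \<le> dist \<theta> (\<theta>h (\<tau> i))"
proof -
  have "closest_point (consistent N' x u \<tau> i) \<theta> = \<theta>"
    using assms(1) by (rule closest_point_self)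
  then show ?thesis
    using assms update_iff_closest_point[OF assms(1)]
      closest_point_lipschitz[OF consistent_convex_closed, of N' x u \<tau> i \<theta> "\<theta>h (\<tau> i)"] by force
qed

lemma update_consistent:
  assumes "\<theta> \<in> consistent N' x u \<tau> i" "update N' x u \<theta>h \<tau> i"
  shows "\<theta>h (\<tau> (Suc i)) \<in> consistent N' x u \<tau> i"
  using assms update_iff_closest_point[OF assms(1)] closest_point_in_set[OF consistent_convex_closed(2)]
  by force

end

section \<open>Existence of hybrid solutions\<close>

context triggered_loop
begin

text \<open>A solution is the limit of prefixes, triples \<open>(x, \<theta>h, \<tau>)\<close> that are correct up to \<open>\<tau>\<^sub>n\<close>, each prolonging
  the one before. The control is not part of the triple, being the feedback of \<open>x\<close> and \<open>\<theta>h\<close>.\<close>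

definition agree_upto :: "real \<Rightarrow> (real \<Rightarrow> real^'n) \<Rightarrow> (real \<Rightarrow> real^'l) \<Rightarrow>
    (real \<Rightarrow> real^'n) \<Rightarrow> (real \<Rightarrow> real^'l) \<Rightarrow> bool"
  where "agree_upto b x \<theta>h x' \<theta>h' \<longleftrightarrow> (\<forall>t\<le>b. x' t = x t \<and> \<theta>h' t = \<theta>h t)"

abbreviation feedback :: "(real \<Rightarrow> real^'n) \<Rightarrow> (real \<Rightarrow> real^'l) \<Rightarrow> real \<Rightarrow> real^'m"
  where "feedback x \<theta>h \<equiv> \<lambda>t. k (\<theta>h t, x t)"

lemma flow_cong:
  assumes flow: "flow \<theta> x (feedback x \<theta>h) \<theta>h \<tau> i"
    and \<tau>: "\<tau> i < \<tau> (Suc i)" "\<tau>' i = \<tau> i" "\<tau>' (Suc i) = \<tau> (Suc i)"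
    and eq: "\<And>t. t < \<tau> (Suc i) \<Longrightarrow> x' t = x t \<and> \<theta>h' t = \<theta>h t"
  shows "flow \<theta> x' (feedback x' \<theta>h') \<theta>h' \<tau>' i"
  unfolding flow_def
proof
  fix t assume "t \<in> {\<tau>' i..<\<tau>' (Suc i)}"
  then have t: "\<tau> i \<le> t" "t < \<tau> (Suc i)"
    using \<tau> by auto
  note D = flowD[OF flow t]
  have "(x' has_vector_derivative f (x t, feedback x \<theta>h t) + g (x t, feedback x \<theta>h t) *v \<theta>)
      (at t within {\<tau> i..<\<tau> (Suc i)})"
    by (rule has_vector_derivative_transform[OF _ _ D(3)]) (use t eq in auto)
  moreover have "x' t = x t" "\<theta>h' t = \<theta>h t" "\<theta>h' (\<tau> i) = \<theta>h (\<tau> i)"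
    using eq \<tau>(1) t by auto
  ultimately show "feedback x' \<theta>h' t = k (\<theta>h' (\<tau>' i), x' t) \<and> \<theta>h' t = \<theta>h' (\<tau>' i) \<and>
      (x' has_vector_derivative f (x' t, feedback x' \<theta>h' t) + g (x' t, feedback x' \<theta>h' t) *v \<theta>)
        (at t within {\<tau>' i..<\<tau>' (Suc i)})"
    using D(2) \<tau> by metis
qed

lemma consistent_cong:
  assumes \<tau>: "\<And>j. j \<le> Suc i \<Longrightarrow> \<tau>' j = \<tau> j" "\<And>j. j \<le> i \<Longrightarrow> \<tau> j \<le> \<tau> (Suc i)"
    and "N' > 0" "\<tau> (Suc i) \<le> \<tau> i + T"
    and eq: "\<And>t. t < \<tau> (Suc i) \<Longrightarrow> x' t = x t \<and> u' t = u t"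
  shows "consistent N' x' u' \<tau>' i = consistent N' x u \<tau> i"
proof -
  obtain m where m: "m \<le> i" "window_start \<tau> T N' i = \<tau> m"
    using window_start_in[OF assms(3) T_pos assms(4)] by blast
  have "{\<tau>' j | j. j \<le> i \<and> \<tau>' j \<ge> \<tau>' (Suc i) - real N' * T} =
      {\<tau> j | j. j \<le> i \<and> \<tau> j \<ge> \<tau> (Suc i) - real N' * T}"
    using \<tau>(1) by (metis (no_types, opaque_lifting) le_SucI order_refl)
  then have w: "window_start \<tau>' T N' i = \<tau> m"
    using m(2) by (simp add: window_start_def)
  have "G_mat g x' u' (\<tau> (Suc i)) (\<tau> m) = G_mat g x u (\<tau> (Suc i)) (\<tau> m)"
    "Z_vec f g x' u' (\<tau> (Suc i)) (\<tau> m) = Z_vec f g x u (\<tau> (Suc i)) (\<tau> m)"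
    using \<tau>(2)[OF m(1)] eq by (auto intro!: G_mat_cong Z_vec_cong)
  then show ?thesis
    by (simp add: consistent_def w m(2) \<tau>(1))
qed

definition prefix :: "nat \<Rightarrow> real^'l \<Rightarrow> real^'n \<Rightarrow> real^'l \<Rightarrow> nat \<Rightarrow>
    (real \<Rightarrow> real^'n) \<times> (real \<Rightarrow> real^'l) \<times> (nat \<Rightarrow> real) \<Rightarrow> bool"
  where "prefix N' \<theta> x0 \<theta>h0 n = (\<lambda>(x, \<theta>h, \<tau>). run \<theta> x (feedback x \<theta>h) \<theta>h \<tau> n \<and> x 0 = x0 \<and> \<theta>h 0 = \<theta>h0 \<and>
    (\<forall>i<n. sampling \<theta> x \<theta>h \<tau> i \<and> update N' x (feedback x \<theta>h) \<theta>h \<tau> i))"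

definition extends :: "nat \<Rightarrow> (real \<Rightarrow> real^'n) \<times> (real \<Rightarrow> real^'l) \<times> (nat \<Rightarrow> real) \<Rightarrow>
    (real \<Rightarrow> real^'n) \<times> (real \<Rightarrow> real^'l) \<times> (nat \<Rightarrow> real) \<Rightarrow> bool"
  where "extends n = (\<lambda>(x, \<theta>h, \<tau>) (x', \<theta>h', \<tau>'). agree_upto (\<tau> n) x \<theta>h x' \<theta>h' \<and> (\<forall>i\<le>n. \<tau>' i = \<tau> i))"

lemma extends_refl: "extends n s s"
  by (auto simp: extends_def agree_upto_def)

lemma extends_trans:
  assumes "extends m s s'" "extends n s' s''" "m \<le> n" "prefix N' \<theta> x0 \<theta>h0 n s'"
  shows "extends m s s''"
proof -
  obtain x \<theta>h \<tau> x' \<theta>h' \<tau>' x'' \<theta>h'' \<tau>'' where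
    s: "s = (x, \<theta>h, \<tau>)" "s' = (x', \<theta>h', \<tau>')" "s'' = (x'', \<theta>h'', \<tau>'')"
    by (metis prod_cases3)
  have "\<tau>' m \<le> \<tau>' n"
    using assms(3,4) by (auto simp: prefix_def s intro: run_mono)
  then have "\<tau> m \<le> \<tau>' n"
    using assms(1) by (auto simp: extends_def s)
  then show ?thesis
    using assms(1-3) by (auto simp: extends_def s agree_upto_def)
qed

text \<open>The clauses of interval \<open>i\<close> only look at data up to \<open>\<tau>\<^sub>i\<^sub>+\<^sub>1\<close>, so they survive every later prolongation
  and pass to the limit.\<close>

lemma step_transfer:
  assumes "prefix N' \<theta> x0 \<theta>h0 (Suc i) (x, \<theta>h, \<tau>)" "extends (Suc i) (x, \<theta>h, \<tau>) (x', \<theta>h', \<tau>')" "N' > 0"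
  shows "\<tau>' i < \<tau>' (Suc i) \<and> flow \<theta> x' (feedback x' \<theta>h') \<theta>h' \<tau>' i \<and> sampling \<theta> x' \<theta>h' \<tau>' i \<and>
    update N' x' (feedback x' \<theta>h') \<theta>h' \<tau>' i"
proof -
  have run: "run \<theta> x (feedback x \<theta>h) \<theta>h \<tau> (Suc i)"
    and samp: "sampling \<theta> x \<theta>h \<tau> i" and upd: "update N' x (feedback x \<theta>h) \<theta>h \<tau> i"
    using assms(1) by (auto simp: prefix_def)
  have less: "\<tau> i < \<tau> (Suc i)" and flow: "flow \<theta> x (feedback x \<theta>h) \<theta>h \<tau> i"
    using run by (auto simp: run_def)
  have \<tau>: "\<And>j. j \<le> Suc i \<Longrightarrow> \<tau>' j = \<tau> j" and eq: "\<And>t. t \<le> \<tau> (Suc i) \<Longrightarrow> x' t = x t \<and> \<theta>h' t = \<theta>h t"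
    using assms(2) by (auto simp: extends_def agree_upto_def)
  have "sampling \<theta> x' \<theta>h' \<tau>' i"
    using samp \<tau> eq less by (simp add: sampling_def)
  moreover have "consistent N' x' (feedback x' \<theta>h') \<tau>' i = consistent N' x (feedback x \<theta>h) \<tau> i"
    using eq \<tau> \<open>N' > 0\<close> sampling_le[OF samp] by (intro consistent_cong run_mono[OF run]) auto
  then have "update N' x' (feedback x' \<theta>h') \<theta>h' \<tau>' i"
    using upd \<tau> eq less by (simp add: update_def)
  moreover have "flow \<theta> x' (feedback x' \<theta>h') \<theta>h' \<tau>' i"
    by (rule flow_cong[OF flow less]) (use \<tau> eq in auto)
  ultimately show ?thesis
    using less \<tau> by simp
qed

lemma prefix_prefix:
  assumes "prefix N' \<theta> x0 \<theta>h0 n s" "m \<le> n"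
  shows "prefix N' \<theta> x0 \<theta>h0 m s"
  using assms by (auto simp: prefix_def intro: run_prefix)

text \<open>First the state is continued to the next event time, then the normal equations are formed, and
  finally their projected solution is stored as the estimate at that time. No circularity arises,
  since the integrals do not see the estimate at the right end of the window.\<close>

lemma prefix_extend:
  assumes s: "prefix N' \<theta> x0 \<theta>h0 n s" and "N' > 0"
  shows "\<exists>s'. prefix N' \<theta> x0 \<theta>h0 (Suc n) s' \<and> extends n s s'"
proof -
  obtain x \<theta>h \<tau> where s_eq: "s = (x, \<theta>h, \<tau>)"
    by (metis prod_cases3)
  have run: "run \<theta> x (feedback x \<theta>h) \<theta>h \<tau> n"
    using s by (simp add: prefix_def s_eq)
  obtain b y where b: "\<tau> n < b"
      "ereal b = min (ereal (\<tau> n + T)) (trigger_time f g k V Q a T \<theta> (\<theta>h (\<tau> n)) (\<tau> n) (x (\<tau> n)))"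
    and y: "y (\<tau> n) = x (\<tau> n)" "ode_solution (F \<theta> (\<theta>h (\<tau> n))) {\<tau> n..b} y"
    using interval_step_exists by blast
  define \<tau>' where "\<tau>' = \<tau>(Suc n := b)"
  define x' where "x' t = (if t \<le> \<tau> n then x t else y t)" for t
  define \<theta>h' where "\<theta>h' c t = (if t \<le> \<tau> n then \<theta>h t else if t < b then \<theta>h (\<tau> n) else c)" for c t
  have \<tau>': "\<tau>' (Suc n) = b" "\<And>j. j \<le> n \<Longrightarrow> \<tau>' j = \<tau> j"
    by (auto simp: \<tau>'_def)
  have ext: "extends n s (x', \<theta>h' c, \<tau>')" for c
    by (auto simp: extends_def agree_upto_def s_eq x'_def \<theta>h'_def \<tau>')
  have n0: "0 \<le> \<tau> n"
    using run_nonneg[OF run] by simp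
  have x'_y: "x' t = y t" if "\<tau> n \<le> t" for t
    using that y(1) by (auto simp: x'_def)
  have "continuous_on ({0..\<tau> n} \<union> {\<tau> n..b}) x'"
  proof (rule continuous_on_closed_Un)
    show "continuous_on {0..\<tau> n} x'"
      using run by (auto simp: run_def x'_def elim: continuous_on_eq)
    show "continuous_on {\<tau> n..b} x'"
      using ode_solution_continuous_on[OF y(2)] by (rule continuous_on_eq) (simp add: x'_y)
  qed auto
  moreover have "{0..\<tau> n} \<union> {\<tau> n..b} = {0..b}"
    using n0 b(1) by auto
  ultimately have cont: "continuous_on {0..b} x'"
    by simp
  have old: "\<tau>' i < \<tau>' (Suc i) \<and> flow \<theta> x' (feedback x' (\<theta>h' c)) (\<theta>h' c) \<tau>' i \<and> sampling \<theta> x' (\<theta>h' c) \<tau>' i \<and>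
      update N' x' (feedback x' (\<theta>h' c)) (\<theta>h' c) \<tau>' i" if "i < n" for i c
  proof (rule step_transfer)
    have "Suc i \<le> n"
      using that by simp
    then show "prefix N' \<theta> x0 \<theta>h0 (Suc i) (x, \<theta>h, \<tau>)"
      using prefix_prefix[OF s] by (simp add: s_eq)
    then show "extends (Suc i) (x, \<theta>h, \<tau>) (x', \<theta>h' c, \<tau>')"
      using extends_trans[OF extends_refl ext \<open>Suc i \<le> n\<close> s] by (simp add: s_eq)
  qed fact
  have new_flow: "flow \<theta> x' (feedback x' (\<theta>h' c)) (\<theta>h' c) \<tau>' n" for c
    unfolding flow_def \<tau>'(1) \<tau>'(2)[OF order_refl]
  proof
    fix t assume t: "t \<in> {\<tau> n..<b}"
    have "(y has_vector_derivative F \<theta> (\<theta>h (\<tau> n)) (y t)) (at t within {\<tau> n..<b})"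
      using ode_solution_subset[OF y(2), of "{\<tau> n..<b}"] t by (fastforce simp: ode_solution_def)
    then have "(x' has_vector_derivative F \<theta> (\<theta>h (\<tau> n)) (y t)) (at t within {\<tau> n..<b})"
      by (rule has_vector_derivative_transform[OF t, rotated]) (simp add: x'_y)
    moreover have "\<theta>h' c t = \<theta>h (\<tau> n)" "\<theta>h' c (\<tau> n) = \<theta>h (\<tau> n)" "x' t = y t"
      using t by (auto simp: \<theta>h'_def x'_y)
    ultimately show "feedback x' (\<theta>h' c) t = k (\<theta>h' c (\<tau> n), x' t) \<and> \<theta>h' c t = \<theta>h' c (\<tau> n) \<and>
        (x' has_vector_derivative f (x' t, feedback x' (\<theta>h' c) t) + g (x' t, feedback x' (\<theta>h' c) t) *v \<theta>)
          (at t within {\<tau> n..<b})"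
      by (simp add: closed_loop_field_def)
  qed
  have run': "run \<theta> x' (feedback x' (\<theta>h' c)) (\<theta>h' c) \<tau>' (Suc n)" for c
    using run old[of _ c] new_flow[of c] b(1) cont by (auto simp: run_def \<tau>' less_Suc_eq)
  have samp: "sampling \<theta> x' (\<theta>h' c) \<tau>' n" for c
    using b(2) by (simp add: sampling_def \<tau>' x'_def \<theta>h'_def)
  \<comment> \<open>the provisional value 0 of the estimate at the new event time does not influence the solution set\<close>
  define c where "c = closest_point (consistent N' x' (feedback x' (\<theta>h' 0)) \<tau>' n) (\<theta>h (\<tau> n))"
  have "consistent N' x' (feedback x' (\<theta>h' c)) \<tau>' n = consistent N' x' (feedback x' (\<theta>h' 0)) \<tau>' n"
    using \<open>N' > 0\<close> sampling_le[OF samp[of c]]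
    by (intro consistent_cong run_mono[OF run'[of c]]) (auto simp: \<theta>h'_def \<tau>')
  then have "c = closest_point (consistent N' x' (feedback x' (\<theta>h' c)) \<tau>' n) (\<theta>h (\<tau> n))"
    by (simp only: c_def[symmetric])
  moreover have "\<theta>h' c (\<tau>' (Suc n)) = c" "\<theta>h' c (\<tau>' n) = \<theta>h (\<tau> n)"
    using b(1) by (auto simp: \<theta>h'_def \<tau>')
  moreover obtain m where "m \<le> n" "window_start \<tau>' T N' n = \<tau>' m"
    using window_start_in[OF \<open>N' > 0\<close> T_pos sampling_le[OF samp[of c]]] by blast
  then have "\<theta> \<in> consistent N' x' (feedback x' (\<theta>h' c)) \<tau>' n"
    by (rule true_parameter_consistent[OF run'])
  ultimately have "update N' x' (feedback x' (\<theta>h' c)) (\<theta>h' c) \<tau>' n"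
    by (simp only: update_iff_closest_point)
  moreover have "x' 0 = x0" "\<theta>h' c 0 = \<theta>h0"
    using s n0 by (auto simp: prefix_def s_eq x'_def \<theta>h'_def)
  ultimately have "prefix N' \<theta> x0 \<theta>h0 (Suc n) (x', \<theta>h' c, \<tau>')"
    using run'[of c] samp[of c] old[of _ c] by (auto simp: prefix_def less_Suc_eq)
  then show ?thesis
    using ext[of c] by blast
qed

text \<open>Dependent choice yields a chain of prefixes; at time \<open>t\<close> the limit takes its value from the first
  prefix that reaches \<open>t\<close>. Beyond all event times the values are irrelevant.\<close>

lemma hybrid_solution_exists:
  assumes "N' > 0"
  shows "\<exists>x u \<theta>h \<tau>. hybrid_solution f g k V Q a T N' \<theta> x0 \<theta>h0 x u \<theta>h \<tau>"
proof -
  have "\<exists>s. prefix N' \<theta> x0 \<theta>h0 0 s"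
    by (rule exI[of _ "(\<lambda>_. x0, \<lambda>_. \<theta>h0, \<lambda>_. 0)"]) (simp add: prefix_def run_def)
  then obtain s where s: "\<And>n. prefix N' \<theta> x0 \<theta>h0 n (s n)" "\<And>n. extends n (s n) (s (Suc n))"
    using dependent_nat_choice[of "prefix N' \<theta> x0 \<theta>h0" "extends"] prefix_extend[OF _ assms] by metis
  have chain: "extends m (s m) (s n)" if "m \<le> n" for m n
    using that
  proof (induction n rule: dec_induct)
    case base
    show ?case by (rule extends_refl)
  next
    case (step n)
    then show ?case
      using extends_trans[OF _ s(2) _ s(1)] by blast
  qed
  define X where "X n = fst (s n)" for n
  define H where "H n = fst (snd (s n))" for n
  define S where "S n = snd (snd (s n))" for n
  define \<tau> where "\<tau> n = S n n" for n
  have s_eq: "s n = (X n, H n, S n)" for n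
    by (simp add: X_def H_def S_def)
  define x where "x t = X (LEAST n. t \<le> \<tau> n) t" for t
  define \<theta>h where "\<theta>h t = H (LEAST n. t \<le> \<tau> n) t" for t
  have agree: "x t = X n t \<and> \<theta>h t = H n t" if "t \<le> \<tau> n" for t n
  proof -
    define m where "m = (LEAST n. t \<le> \<tau> n)"
    have "t \<le> \<tau> m" "m \<le> n"
      using that unfolding m_def by (auto intro: LeastI Least_le)
    then have "X n t = X m t" "H n t = H m t"
      using chain[OF \<open>m \<le> n\<close>]
      by (auto simp: extends_def agree_upto_def \<tau>_def s_eq)
    then show ?thesis
      by (simp add: x_def \<theta>h_def m_def)
  qed
  have ext: "extends n (s n) (x, \<theta>h, \<tau>)" for n
  proof -
    have "agree_upto (S n n) (X n) (H n) x \<theta>h"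
      using agree[of _ n] by (simp add: agree_upto_def \<tau>_def[of n])
    moreover have "\<forall>i\<le>n. \<tau> i = S n i"
      using chain by (auto simp: extends_def s_eq \<tau>_def)
    ultimately show ?thesis
      by (simp only: s_eq extends_def case_prod_conv simp_thms)
  qed
  have step: "\<tau> i < \<tau> (Suc i) \<and> flow \<theta> x (feedback x \<theta>h) \<theta>h \<tau> i \<and> sampling \<theta> x \<theta>h \<tau> i \<and>
      update N' x (feedback x \<theta>h) \<theta>h \<tau> i" for i
    by (rule step_transfer[OF s(1)[of "Suc i", unfolded s_eq] ext[of "Suc i", unfolded s_eq] assms])
  have init: "\<tau> 0 = 0" "x 0 = x0" "\<theta>h 0 = \<theta>h0"
    using s(1)[of 0] ext[of 0] by (auto simp: prefix_def extends_def agree_upto_def run_def s_eq)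
  have cont: "continuous_on {0..\<tau> n} x" for n
  proof -
    have "continuous_on {0..\<tau> n} (X n)"
      using s(1)[of n] by (auto simp: prefix_def run_def s_eq \<tau>_def)
    then show ?thesis
      by (rule continuous_on_eq) (use agree[of _ n] in auto)
  qed
  define U where "U = (\<Union>i. {\<tau> i..<\<tau> (Suc i)})"
  have mono: "strict_mono \<tau>"
    using step by (simp add: strict_mono_Suc_iff)
  have U0: "0 \<le> t" if t: "t \<in> U" for t
  proof -
    obtain i where "\<tau> i \<le> t"
      using t by (auto simp: U_def)
    moreover have "\<tau> 0 \<le> \<tau> i"
      by (simp add: strict_mono_less_eq[OF mono])
    ultimately show ?thesis
      using init(1) by simp
  qed
  have "continuous_on U x"
    unfolding continuous_on_eq_continuous_within
  proof
    fix t assume "t \<in> U"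
    then obtain i where i: "t < \<tau> (Suc i)"
      by (auto simp: U_def)
    have "{..<\<tau> (Suc i)} \<inter> U \<subseteq> {0..\<tau> (Suc i)}"
      using U0 by auto
    then have "continuous_on (U \<inter> {..<\<tau> (Suc i)}) x"
      using cont continuous_on_subset by (metis inf_commute)
    then have "continuous (at t within U \<inter> {..<\<tau> (Suc i)}) x"
      using \<open>t \<in> U\<close> i by (simp add: continuous_on_eq_continuous_within)
    moreover have "at t within U = at t within U \<inter> {..<\<tau> (Suc i)}"
      by (rule at_within_nhd[where S = "{..<\<tau> (Suc i)}"]) (use i in auto)
    ultimately show "continuous (at t within U) x"
      by simp
  qed
  then have "hybrid_solution f g k V Q a T N' \<theta> x0 \<theta>h0 x (feedback x \<theta>h) \<theta>h \<tau>"
    using init mono step by (auto simp: hybrid_solution_iff U_def)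
  then show ?thesis by blast
qed

end

section \<open>Identification and exponential decay\<close>

lemma C1_differentiable_onI:
  assumes "\<And>t. t \<in> S \<Longrightarrow> (x has_vector_derivative D t) (at t)" "\<And>t. t \<in> S \<Longrightarrow> isCont D t"
  shows "x C1_differentiable_on S"
  unfolding C1_differentiable_on_def
  using assms by (auto intro: continuous_at_imp_continuous_on)

lemma filterlim_eventually_arithmetic:
  fixes \<tau> :: "nat \<Rightarrow> real"
  assumes "T > 0" "\<And>i. n \<le> i \<Longrightarrow> \<tau> (Suc i) = \<tau> i + T"
  shows "filterlim \<tau> at_top sequentially"
proof -
  have "\<tau> (j + n) = \<tau> n + T * real j" for j
    using assms(2) by (induction j) (auto simp: algebra_simps)
  moreover have "filterlim (\<lambda>j. \<tau> n + T * real j) at_top sequentially"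
    by (intro filterlim_tendsto_add_at_top[OF tendsto_const] filterlim_real_sequentially
        filterlim_tendsto_pos_mult_at_top[OF tendsto_const \<open>T > 0\<close>])
  ultimately have "filterlim (\<lambda>j. \<tau> (j + n)) at_top sequentially"
    by simp
  then show ?thesis
    unfolding filterlim_iff by (metis (mono_tags, lifting) eventually_mono eventually_sequentially_seg)
qed

text \<open>Here assumption (iii) enters, together with the part of assumption (i) that keeps the trigger silent
  under the exact estimate.\<close>

locale identifiable_loop = triggered_loop f g k V Q a T
  for f :: "(real^'n) \<times> (real^'m) \<Rightarrow> real^'n"
    and g :: "(real^'n) \<times> (real^'m) \<Rightarrow> real^'l^'n"
    and k :: "(real^'l) \<times> (real^'n) \<Rightarrow> real^'m"
    and V Q :: "real^'l \<Rightarrow> real^'n \<Rightarrow> real"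
    and a :: "real^'n \<Rightarrow> real"
    and T :: real +
  fixes N N' :: nat
  assumes N': "N' > N"
    and identifiability: "\<And>(\<tau> :: nat \<Rightarrow> real) (\<theta> :: real^'l) (d :: nat \<Rightarrow> real^'l) (x :: real \<Rightarrow> real^'n).
              \<tau> 0 = 0 \<Longrightarrow> (\<forall>i<N. \<tau> i < \<tau> (Suc i)) \<Longrightarrow> (\<forall>i\<le>N. d i \<noteq> 0) \<Longrightarrow>
              continuous_on {0..\<tau> N} x \<Longrightarrow>
              x C1_differentiable_on ({0..\<tau> N} - \<tau> ` {0..N}) \<Longrightarrow>
              (\<forall>i<N. \<forall>t\<in>{\<tau> i..<\<tau> (Suc i)}.
                 (x has_vector_derivative
                    f (x t, k (\<theta> + d i, x t)) + g (x t, k (\<theta> + d i, x t)) *v \<theta>) (at_right t)) \<Longrightarrow>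
              (\<forall>i<N. \<forall>j\<le>i. \<forall>t\<in>{\<tau> j..\<tau> (Suc j)}.
                 g (x t, k (\<theta> + d j, x t)) *v d (Suc i) = 0) \<Longrightarrow>
              (\<forall>t\<in>{0..\<tau> N}. x t = 0)"
    and solutions: "\<And>\<theta> x0. \<exists>y. ode_solution (closed_loop_field f g k \<theta> \<theta>) {0..} y \<and> y 0 = x0"
    and V_le_Q: "\<And>\<theta> y t. ode_solution (closed_loop_field f g k \<theta> \<theta>) {0..} y \<Longrightarrow> t \<ge> 0 \<Longrightarrow>
              V \<theta> (y t) \<le> Q \<theta> (y 0)"
    and a_pos: "\<And>x. x \<noteq> 0 \<Longrightarrow> a x > 0"
begin

lemma N'_pos: "N' > 0"
  using N' by simp

context
  fixes \<theta> :: "real^'l" and x0 :: "real^'n" and \<theta>h0 :: "real^'l"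
    and x :: "real \<Rightarrow> real^'n" and u :: "real \<Rightarrow> real^'m" and \<theta>h :: "real \<Rightarrow> real^'l" and \<tau> :: "nat \<Rightarrow> real"
  assumes sol: "hybrid_solution f g k V Q a T N' \<theta> x0 \<theta>h0 x u \<theta>h \<tau>"
begin

lemma initial: "x 0 = x0" "\<theta>h 0 = \<theta>h0" "\<tau> 0 = 0"
  and \<tau>_mono: "strict_mono \<tau>"
  and flow: "flow \<theta> x u \<theta>h \<tau> i"
  and sampling: "sampling \<theta> x \<theta>h \<tau> i"
  and update: "update N' x u \<theta>h \<tau> i"
  using sol by (auto simp: hybrid_solution_iff)

lemma hybrid_continuous: "0 \<le> s \<Longrightarrow> continuous_on {s..\<tau> n} x"
proof (rule continuous_on_subset)
  show "continuous_on (\<Union>i. {\<tau> i..<\<tau> (Suc i)}) x"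
    using sol by (simp add: hybrid_solution_iff)
  assume "0 \<le> s"
  show "{s..\<tau> n} \<subseteq> (\<Union>i. {\<tau> i..<\<tau> (Suc i)})"
  proof
    fix t assume "t \<in> {s..\<tau> n}"
    then have "\<tau> 0 \<le> t" "t < \<tau> (Suc n)"
      using \<open>0 \<le> s\<close> initial(3) strict_monoD[OF \<tau>_mono, of n "Suc n"] by auto
    then show "t \<in> (\<Union>i. {\<tau> i..<\<tau> (Suc i)})"
      by (rule bracketing_interval) auto
  qed
qed

lemma hybrid_run: "run \<theta> x u \<theta>h \<tau> n"
  unfolding run_def
  using initial flow hybrid_continuous strict_monoD[OF \<tau>_mono] by simp

lemma \<tau>_nonneg: "0 \<le> \<tau> i"
  using run_nonneg[OF hybrid_run order_refl] .

lemma \<tau>_le: "\<tau> i \<le> real i * T"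
proof (induction i)
  case (Suc i)
  then show ?case
    using sampling_le[OF sampling, of i] by (simp add: algebra_simps)
qed (simp add: initial)

lemma hybrid_ode_solution: "ode_solution (F \<theta> (\<theta>h (\<tau> i))) {\<tau> i..<\<tau> (Suc i)} x"
  unfolding ode_solution_def closed_loop_field_def
  using flowD(1,3)[OF flow, of i] by (metis atLeastLessThan_iff)

lemma hybrid_derivative:
  assumes "t \<in> {\<tau> i<..<\<tau> (Suc i)}"
  shows "(x has_vector_derivative F \<theta> (\<theta>h (\<tau> i)) (x t)) (at t)"
proof -
  have "{\<tau> i<..<\<tau> (Suc i)} \<subseteq> {\<tau> i..<\<tau> (Suc i)}"
    by auto
  from ode_solution_subset[OF hybrid_ode_solution this] show ?thesis
    using assms by (auto simp: ode_solution_def at_within_open[OF _ open_greaterThanLessThan])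
qed

lemma hybrid_true_parameter_consistent: "\<theta> \<in> consistent N' x u \<tau> i"
  using window_start_in[OF N'_pos T_pos sampling_le[OF sampling, of i]]
    true_parameter_consistent[OF hybrid_run, of _ i] by metis

lemma estimate_error_decreasing: "i \<le> j \<Longrightarrow> dist \<theta> (\<theta>h (\<tau> j)) \<le> dist \<theta> (\<theta>h (\<tau> i))"
proof (induction j rule: dec_induct)
  case (step j)
  then show ?case
    using update_nonexpansive[OF hybrid_true_parameter_consistent update] order_trans by blast
qed simp

lemma identified_stays: "\<theta>h (\<tau> i) = \<theta> \<Longrightarrow> i \<le> j \<Longrightarrow> \<theta>h (\<tau> j) = \<theta>"
  using estimate_error_decreasing[of i j] by simp

text \<open>After at most \<open>N\<close> intervals, less than \<open>N' T\<close> has elapsed, so the first event is still in the window.\<close>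

lemma early_window_start:
  assumes "i < N"
  shows "window_start \<tau> T N' i = \<tau> 0"
  unfolding window_start_def
proof (rule Min_eqI)
  have "real (Suc i) * T \<le> real N' * T"
    using assms N' T_pos by (intro mult_right_mono) auto
  then have "\<tau> (Suc i) - real N' * T \<le> \<tau> 0"
    using \<tau>_le[of "Suc i"] initial(3) by linarith
  then show "\<tau> 0 \<in> {\<tau> j |j. j \<le> i \<and> \<tau> (Suc i) - real N' * T \<le> \<tau> j}"
    by blast
  show "finite {\<tau> j |j. j \<le> i \<and> \<tau> (Suc i) - real N' * T \<le> \<tau> j}"
    by (rule finite_subset[of _ "\<tau> ` {..i}"]) auto
  show "\<tau> 0 \<le> s" if "s \<in> {\<tau> j |j. j \<le> i \<and> \<tau> (Suc i) - real N' * T \<le> \<tau> j}" for s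
    using that \<tau>_nonneg initial(3) by auto
qed

text \<open>Were the estimate at \<open>\<tau>\<^sub>N\<close> wrong, all earlier ones would be wrong too, since a correct estimate is kept.
  The errors then form a family \<open>d\<close> as in the identifiability assumption: every window starts at
  time 0, so each new error is annihilated by the regressor on all preceding intervals.\<close>

lemma identification:
  assumes "x0 \<noteq> 0" "N \<le> i"
  shows "\<theta>h (\<tau> i) = \<theta>"
proof -
  have "\<theta>h (\<tau> N) = \<theta>"
  proof (rule ccontr)
    assume wrong: "\<theta>h (\<tau> N) \<noteq> \<theta>"
    define d where "d i = \<theta>h (\<tau> i) - \<theta>" for i
    have d: "\<theta> + d i = \<theta>h (\<tau> i)" for i
      by (simp add: d_def)
    have "\<forall>t\<in>{0..\<tau> N}. x t = 0"
    proof (rule identifiability[where d = d and \<theta> = \<theta>])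
      show "\<tau> 0 = 0" "\<forall>i<N. \<tau> i < \<tau> (Suc i)" "continuous_on {0..\<tau> N} x"
        using initial(3) \<tau>_mono hybrid_continuous by (auto simp: strict_mono_Suc_iff)
      show "\<forall>i\<le>N. d i \<noteq> 0"
        using wrong identified_stays by (auto simp: d_def)
      show "x C1_differentiable_on {0..\<tau> N} - \<tau> ` {0..N}"
      proof (rule C1_differentiable_onI[where D = "\<lambda>t. f (x t, u t) + g (x t, u t) *v \<theta>"])
        fix t assume t: "t \<in> {0..\<tau> N} - \<tau> ` {0..N}"
        then have "t \<noteq> 0" "t \<noteq> \<tau> N"
          using initial(3) by (metis DiffE atLeastAtMost_iff imageI le0 order_refl)+
        then have t': "t \<in> {0<..<\<tau> N} - \<tau> ` {..N}"
          using t by (auto simp: atLeast0AtMost)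
        then show "(x has_vector_derivative f (x t, u t) + g (x t, u t) *v \<theta>) (at t)"
          by (rule run_derivative[OF hybrid_run])
        obtain i where i: "i < N" "\<tau> i \<le> t" "t < \<tau> (Suc i)"
          using bracketing_interval[of \<tau> t N] t' initial(3) by auto
        then have ti: "t \<in> {\<tau> i<..<\<tau> (Suc i)}"
          using t by (auto simp: le_less)
        have "continuous_on {\<tau> i<..<\<tau> (Suc i)} x"
          by (rule continuous_on_subset[OF hybrid_continuous[OF \<tau>_nonneg, of i "Suc i"]]) auto
        then have "continuous_on {\<tau> i<..<\<tau> (Suc i)} (\<lambda>t. F \<theta> (\<theta>h (\<tau> i)) (x t))"
          by (intro continuous_on_compose2[OF lipschitz_on_balls_imp_continuous_on[OF field_lipschitz]]) auto
        then have "continuous_on {\<tau> i<..<\<tau> (Suc i)} (\<lambda>t. f (x t, u t) + g (x t, u t) *v \<theta>)"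
          by (rule continuous_on_eq) (simp add: closed_loop_field_def flowD(1)[OF flow, of i])
        then show "isCont (\<lambda>t. f (x t, u t) + g (x t, u t) *v \<theta>) t"
          using ti by (simp add: continuous_on_eq_continuous_at)
      qed
      show "\<forall>i<N. \<forall>t\<in>{\<tau> i..<\<tau> (Suc i)}. (x has_vector_derivative
          f (x t, k (\<theta> + d i, x t)) + g (x t, k (\<theta> + d i, x t)) *v \<theta>) (at_right t)"
      proof (intro allI impI ballI)
        fix i t assume t: "t \<in> {\<tau> i..<\<tau> (Suc i)}"
        define c where "c = (t + \<tau> (Suc i)) / 2"
        have c: "t < c" "c < \<tau> (Suc i)"
          using t by (auto simp: c_def)
        have "{t..c} \<subseteq> {\<tau> i..<\<tau> (Suc i)}"
          using t c by auto
        from ode_solution_subset[OF hybrid_ode_solution this]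
        have "(x has_vector_derivative F \<theta> (\<theta>h (\<tau> i)) (x t)) (at t within {t..c})"
          using c by (auto simp: ode_solution_def)
        then show "(x has_vector_derivative
            f (x t, k (\<theta> + d i, x t)) + g (x t, k (\<theta> + d i, x t)) *v \<theta>) (at_right t)"
          using c by (simp add: at_within_Icc_at_right closed_loop_field_def d)
      qed
      show "\<forall>i<N. \<forall>j\<le>i. \<forall>t\<in>{\<tau> j..\<tau> (Suc j)}. g (x t, k (\<theta> + d j, x t)) *v d (Suc i) = 0"
      proof (intro allI impI ballI)
        fix i j t assume "i < N" "j \<le> i" "t \<in> {\<tau> j..\<tau> (Suc j)}"
        moreover have "\<theta>h (\<tau> (Suc i)) \<in> consistent N' x u \<tau> i"
          using hybrid_true_parameter_consistent update by (rule update_consistent)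
        ultimately show "g (x t, k (\<theta> + d j, x t)) *v d (Suc i) = 0"
          unfolding d unfolding d_def
          by (intro consistent_imp_regressor_kernel[OF hybrid_run le0 early_window_start])
      qed
    qed
    then show False
      using initial(1) \<tau>_nonneg \<open>x0 \<noteq> 0\<close> by auto
  qed
  then show ?thesis
    using \<open>N \<le> i\<close> by (rule identified_stays)
qed

text \<open>The estimates never move further from \<open>\<theta>\<close> than the initial one, so the same constant \<open>L\<close> bounds the
  field on every interval and the exponential bounds of successive intervals multiply.\<close>

lemma growth_bound:
  assumes "L \<ge> 0"
    and L: "\<And>\<eta> z. dist \<theta> \<eta> \<le> dist \<theta> \<theta>h0 \<Longrightarrow> norm z \<le> 1 \<Longrightarrow> norm (F \<theta> \<eta> z) \<le> L * norm z"
    and small: "exp (L * \<tau> n) * norm x0 < 1" and t: "t \<in> {0..\<tau> n}"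
  shows "norm (x t) \<le> exp (L * t) * norm x0"
proof -
  have "\<forall>t\<in>{0..\<tau> i}. norm (x t) \<le> exp (L * t) * norm x0" if "i \<le> n" for i
    using that
  proof (induction i)
    case 0
    then show ?case using initial by simp
  next
    case (Suc i)
    show ?case
    proof
      fix t assume t: "t \<in> {0..\<tau> (Suc i)}"
      show "norm (x t) \<le> exp (L * t) * norm x0"
      proof (cases "t \<le> \<tau> i")
        case True
        then show ?thesis using Suc t by simp
      next
        case False
        have "\<tau> (Suc i) \<le> \<tau> n"
          using Suc.prems strict_mono_less_eq[OF \<tau>_mono] by simp
        then have tn: "t \<le> \<tau> n"
          using t by simp
        have "exp (L * (t - \<tau> i)) * norm (x (\<tau> i)) \<le> exp (L * (t - \<tau> i)) * (exp (L * \<tau> i) * norm x0)"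
          using Suc \<tau>_nonneg[of i] by (intro mult_left_mono) auto
        also have "\<dots> = exp (L * t) * norm x0"
          by (simp add: exp_add[symmetric] algebra_simps)
        finally have step: "exp (L * (t - \<tau> i)) * norm (x (\<tau> i)) \<le> exp (L * t) * norm x0" .
        also have "\<dots> \<le> exp (L * \<tau> n) * norm x0"
          using tn \<open>L \<ge> 0\<close> by (intro mult_right_mono) (auto simp: mult_left_mono)
        finally have "exp (L * (t - \<tau> i)) * norm (x (\<tau> i)) < 1"
          using small by simp
        moreover have "continuous_on {\<tau> i..t} x"
          by (rule continuous_on_subset[OF hybrid_continuous[OF \<tau>_nonneg, of i n]]) (use tn in auto)
        moreover have "dist \<theta> (\<theta>h (\<tau> i)) \<le> dist \<theta> \<theta>h0"
          using estimate_error_decreasing[of 0 i] initial by simp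
        ultimately have "norm (x t) \<le> exp (L * (t - \<tau> i)) * norm (x (\<tau> i))"
          using t False \<open>L \<ge> 0\<close>
          by (intro gronwall_local[where w' = "\<lambda>r. F \<theta> (\<theta>h (\<tau> i)) (x r)"] hybrid_derivative L) auto
        then show ?thesis
          using step by linarith
      qed
    qed
  qed
  then show ?thesis using t by blast
qed

lemma zero_trajectory:
  assumes "x0 = 0"
  shows "t \<in> {0..\<tau> n} \<Longrightarrow> x t = 0"
proof -
  obtain L where "L \<ge> 0" "\<And>\<eta> z. \<eta> \<in> cball \<theta> (dist \<theta> \<theta>h0) \<Longrightarrow> norm z \<le> 1 \<Longrightarrow> norm (F \<theta> \<eta> z) \<le> L * norm z"
    using field_linear_growth[OF bounded_cball] by metis
  then show ?thesis if "t \<in> {0..\<tau> n}"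
    using growth_bound[of L n t] that assms by simp
qed

text \<open>Either the estimate is exact and the trigger silent, or the state is at the origin, where the next
  event is scheduled after time \<open>T\<close> anyway.\<close>

lemma full_period:
  assumes "N \<le> i"
  shows "\<tau> (Suc i) = \<tau> i + T"
proof -
  have "ereal (\<tau> i + T) \<le> trigger_time f g k V Q a T \<theta> (\<theta>h (\<tau> i)) (\<tau> i) (x (\<tau> i))"
  proof (cases "x0 = 0")
    case True
    then show ?thesis
      using zero_trajectory[of "\<tau> i" i] \<tau>_nonneg by (simp add: trigger_time_def)
  next
    case False
    show ?thesis
      unfolding identification[OF False assms]
      by (intro no_trigger_under_true_parameter solutions V_le_Q a_pos)
  qed
  then show ?thesis
    using sampling[of i] by (simp add: sampling_def min_absorb1)
qed

lemma no_accumulation: "filterlim \<tau> at_top sequentially"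
  using T_pos full_period by (rule filterlim_eventually_arithmetic)

lemma event_after: obtains i where "n \<le> i" "t < \<tau> i"
proof -
  have "\<forall>\<^sub>F i in sequentially. t < \<tau> i \<and> n \<le> i"
    using no_accumulation by (intro eventually_conj filterlim_at_top_dense[THEN iffD1, rule_format] eventually_ge_at_top)
  then show thesis
    using that by (auto simp: eventually_sequentially)
qed

text \<open>Comparison with a given global solution by uniqueness, interval after interval, avoids having to
  glue the pieces of \<open>x\<close> into a differentiable function across the event times.\<close>

lemma follows_nominal_after_identification:
  assumes "x0 \<noteq> 0" and y: "ode_solution (F \<theta> \<theta>) {0..} y" "y 0 = x (\<tau> N)" and "\<tau> N \<le> t"
  shows "x t = y (t - \<tau> N)"
proof -
  have "\<forall>t\<in>{\<tau> N..\<tau> i}. x t = y (t - \<tau> N)" if "N \<le> i" for i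
    using that
  proof (induction i rule: dec_induct)
    case base
    then show ?case using y(2) by simp
  next
    case (step i)
    have le: "\<tau> N \<le> \<tau> i"
      using step strict_mono_less_eq[OF \<tau>_mono] by simp
    have xs: "ode_solution (F \<theta> \<theta>) {\<tau> i..<\<tau> (Suc i)} x"
      using hybrid_ode_solution[of i] identification[OF assms(1) step(1)] by simp
    have ys: "ode_solution (F \<theta> \<theta>) {\<tau> i..\<tau> (Suc i)} (\<lambda>t. y (t - \<tau> N))"
      using le by (intro ode_solution_shift[OF y(1)]) auto
    have "{\<tau> i..<\<tau> (Suc i)} \<subseteq> {\<tau> i..\<tau> (Suc i)}"
      by auto
    note uniq = ode_solution_unique[OF field_lipschitz hybrid_continuous[OF \<tau>_nonneg] xs
        ode_solution_continuous_on[OF ys] ode_solution_subset[OF ys this]]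
    show ?case
    proof
      fix t assume t: "t \<in> {\<tau> N..\<tau> (Suc i)}"
      show "x t = y (t - \<tau> N)"
      proof (cases "t \<le> \<tau> i")
        case True
        then show ?thesis using step t by simp
      next
        case False
        then show ?thesis
          using uniq[of t] step.IH le t by simp
      qed
    qed
  qed
  moreover obtain i where "N \<le> i" "t < \<tau> i"
    by (rule event_after)
  ultimately show ?thesis
    using assms(4) by simp
qed

end

text \<open>Up to \<open>\<tau>\<^sub>N \<le> N T\<close> the state grows at most by the factor \<open>C = exp (L N T)\<close>, and afterwards it decays at
  rate \<open>\<omega>\<close>. The factor \<open>E = exp (\<omega> N T)\<close> pays for the decay that has not started before \<open>\<tau>\<^sub>N\<close>. The radius
  keeps the state in the unit ball until \<open>\<tau>\<^sub>N\<close>, where the growth bound is valid, and brings it into the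
  ball of radius \<open>R\<close> at \<open>\<tau>\<^sub>N\<close>, where the nominal estimate applies.\<close>

lemma exponential_stability:
  assumes pos: "M > 0" "\<omega> > 0" "R > 0"
    and decay: "\<And>y t. ode_solution (F \<theta> \<theta>) {0..} y \<Longrightarrow> norm (y 0) \<le> R \<Longrightarrow> t \<ge> 0 \<Longrightarrow>
       norm (y t) \<le> M * exp (- \<omega> * t) * norm (y 0)"
  shows "\<exists>Mt Rt. Mt > 0 \<and> Rt > 0 \<and> (\<forall>x0 x u \<theta>h \<tau>. norm x0 \<le> Rt \<longrightarrow>
    hybrid_solution f g k V Q a T N' \<theta> x0 \<theta>h0 x u \<theta>h \<tau> \<longrightarrow>
    (\<forall>t\<ge>0. norm (x t) \<le> Mt * exp (- \<omega> * t) * norm x0))"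
proof -
  obtain L where L: "L \<ge> 0"
    "\<And>\<eta> z. dist \<theta> \<eta> \<le> dist \<theta> \<theta>h0 \<Longrightarrow> norm z \<le> 1 \<Longrightarrow> norm (F \<theta> \<eta> z) \<le> L * norm z"
    using field_linear_growth[OF bounded_cball[of \<theta> "dist \<theta> \<theta>h0"], of \<theta>] by (metis mem_cball)
  define C where "C = exp (L * (real N * T))"
  define E where "E = exp (\<omega> * (real N * T))"
  have "C \<ge> 1" "E \<ge> 1"
    using L(1) T_pos pos by (auto simp: C_def E_def)
  define Mt where "Mt = max 1 M * E * C"
  define Rt where "Rt = min (1 / (2 * C)) (R / C)"
  have "norm (x t) \<le> Mt * exp (- \<omega> * t) * norm x0"
    if x0: "norm x0 \<le> Rt" and sol: "hybrid_solution f g k V Q a T N' \<theta> x0 \<theta>h0 x u \<theta>h \<tau>" and t: "t \<ge> 0"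
    for x0 x u \<theta>h \<tau> t
  proof (cases "x0 = 0")
    case True
    obtain i where "t < \<tau> i"
      using event_after[OF sol] by blast
    then show ?thesis
      using zero_trajectory[OF sol True, of t i] t True by simp
  next
    case False
    have \<tau>N: "0 \<le> \<tau> N" "\<tau> N \<le> real N * T"
      using \<tau>_nonneg[OF sol] \<tau>_le[OF sol] by auto
    have expL: "exp (L * s) \<le> C" if "s \<le> \<tau> N" for s
      using that \<tau>N L(1) by (auto simp: C_def intro!: mult_left_mono)
    have "C * norm x0 \<le> 1 / 2" "C * norm x0 \<le> R"
      using x0 \<open>C \<ge> 1\<close> by (auto simp: Rt_def field_simps)
    have "exp (L * \<tau> N) * norm x0 \<le> C * norm x0"
      using expL by (intro mult_right_mono) auto
    also have "\<dots> < 1"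
      using \<open>C * norm x0 \<le> 1 / 2\<close> by simp
    finally have small: "exp (L * \<tau> N) * norm x0 < 1" .
    have early: "norm (x s) \<le> C * norm x0" if "s \<in> {0..\<tau> N}" for s
    proof -
      have "norm (x s) \<le> exp (L * s) * norm x0"
        using growth_bound[OF sol L(1) _ small that] L(2) by blast
      also have "\<dots> \<le> C * norm x0"
        using that expL by (intro mult_right_mono) auto
      finally show ?thesis .
    qed
    show ?thesis
    proof (cases "t \<le> \<tau> N")
      case True
      have "\<omega> * t \<le> \<omega> * (real N * T)"
        using True \<tau>N pos by (intro mult_left_mono) auto
      then have "1 \<le> E * exp (- \<omega> * t)"
        by (simp add: E_def exp_add[symmetric])
      then have "1 * 1 \<le> max 1 M * (E * exp (- \<omega> * t))"
        by (intro mult_mono) auto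
      then have "1 * (C * norm x0) \<le> max 1 M * (E * exp (- \<omega> * t)) * (C * norm x0)"
        using \<open>C \<ge> 1\<close> by (intro mult_right_mono) auto
      then show ?thesis
        using early[of t] True t by (simp add: Mt_def mult_ac)
    next
      case False
      obtain y where y: "ode_solution (F \<theta> \<theta>) {0..} y" "y 0 = x (\<tau> N)"
        using solutions by blast
      have yN: "norm (y 0) \<le> C * norm x0"
        using early[of "\<tau> N"] \<tau>N y(2) by simp
      have "norm (x t) = norm (y (t - \<tau> N))"
        using follows_nominal_after_identification[OF sol \<open>x0 \<noteq> 0\<close> y, of t] False by simp
      also have "\<dots> \<le> M * exp (- \<omega> * (t - \<tau> N)) * norm (y 0)"
        using yN \<open>C * norm x0 \<le> R\<close> False by (intro decay[OF y(1)]) auto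
      also have "\<dots> \<le> M * exp (- \<omega> * (t - \<tau> N)) * (C * norm x0)"
        using yN pos by (intro mult_left_mono) auto
      also have "exp (- \<omega> * (t - \<tau> N)) = exp (\<omega> * \<tau> N) * exp (- \<omega> * t)"
        by (simp add: exp_add[symmetric] algebra_simps)
      also have "M * (exp (\<omega> * \<tau> N) * exp (- \<omega> * t)) * (C * norm x0)
          \<le> max 1 M * (E * exp (- \<omega> * t)) * (C * norm x0)"
        using \<open>C \<ge> 1\<close> pos \<tau>N by (intro mult_right_mono mult_mono) (auto simp: E_def)
      finally show ?thesis
        by (simp add: Mt_def mult_ac)
    qed
  qed
  moreover have "Mt > 0" "Rt > 0"
    using \<open>C \<ge> 1\<close> \<open>E \<ge> 1\<close> pos by (auto simp: Mt_def Rt_def intro!: mult_pos_pos)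
  ultimately show ?thesis by blast
qed

end

section \<open>Exponential regulation\<close>

theorem theorem4p2:
  fixes f :: "(real^'n) \<times> (real^'m) \<Rightarrow> real^'n"
    and g :: "(real^'n) \<times> (real^'m) \<Rightarrow> real^'l^'n"
    and k :: "(real^'l) \<times> (real^'n) \<Rightarrow> real^'m"
    and V Q :: "real^'l \<Rightarrow> real^'n \<Rightarrow> real"
    and M \<omega> R :: "real^'l \<Rightarrow> real"
    and a :: "real^'n \<Rightarrow> real"
    and T :: real
    and N N' :: nat
  assumes f: "smooth f" "f (0, 0) = 0"
    and g: "smooth g" "g (0, 0) = 0"
    and k: "smooth k" "\<And>\<theta>. k (\<theta>, 0) = 0"
    and V: "\<And>\<theta> x. V \<theta> x \<ge> 0" "\<And>\<theta>. continuous_on UNIV (V \<theta>)"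
           "\<And>\<theta>. positive_definite (V \<theta>)" "\<And>\<theta>. radially_unbounded (V \<theta>)"
           "continuous_on UNIV (\<lambda>(\<theta>, x). V \<theta> x)"
    and Q: "\<And>\<theta> x. Q \<theta> x \<ge> 0" "\<And>\<theta>. continuous_on UNIV (Q \<theta>)"
           "\<And>\<theta>. positive_definite (Q \<theta>)" "\<And>\<theta>. radially_unbounded (Q \<theta>)"
           "continuous_on UNIV (\<lambda>(\<theta>, x). Q \<theta> x)"
    and i: "\<And>\<theta>. globally_asymptotically_stable (closed_loop_field f g k \<theta> \<theta>)"
           "\<And>\<theta> x t. ode_solution (closed_loop_field f g k \<theta> \<theta>) {0..} x \<Longrightarrow> t \<ge> 0 \<Longrightarrow>
              V \<theta> (x t) \<le> Q \<theta> (x 0)"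
    and ii: "\<And>\<Theta> B. \<Theta> \<noteq> {} \<Longrightarrow> compact \<Theta> \<Longrightarrow> B \<ge> 0 \<Longrightarrow>
              \<exists>r>0. \<forall>\<theta>\<in>\<Theta>. \<forall>x. V \<theta> x \<le> B \<longrightarrow> norm x \<le> r"
    and N: "N > 0"
    and iii: "\<And>(\<tau> :: nat \<Rightarrow> real) (\<theta> :: real^'l) (d :: nat \<Rightarrow> real^'l) (x :: real \<Rightarrow> real^'n).
              \<tau> 0 = 0 \<Longrightarrow> (\<forall>i<N. \<tau> i < \<tau> (Suc i)) \<Longrightarrow> (\<forall>i\<le>N. d i \<noteq> 0) \<Longrightarrow>
              continuous_on {0..\<tau> N} x \<Longrightarrow>
              x C1_differentiable_on ({0..\<tau> N} - \<tau> ` {0..N}) \<Longrightarrow>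
              (\<forall>i<N. \<forall>t\<in>{\<tau> i..<\<tau> (Suc i)}.
                 (x has_vector_derivative
                    f (x t, k (\<theta> + d i, x t)) + g (x t, k (\<theta> + d i, x t)) *v \<theta>) (at_right t)) \<Longrightarrow>
              (\<forall>i<N. \<forall>j\<le>i. \<forall>t\<in>{\<tau> j..\<tau> (Suc j)}.
                 g (x t, k (\<theta> + d j, x t)) *v d (Suc i) = 0) \<Longrightarrow>
              (\<forall>t\<in>{0..\<tau> N}. x t = 0)"
    and iv: "\<And>\<theta>. M \<theta> > 0" "\<And>\<theta>. \<omega> \<theta> > 0" "\<And>\<theta>. R \<theta> > 0"
            "\<And>\<theta> x t. ode_solution (closed_loop_field f g k \<theta> \<theta>) {0..} x \<Longrightarrow>
               norm (x 0) \<le> R \<theta> \<Longrightarrow> t \<ge> 0 \<Longrightarrow>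
               norm (x t) \<le> M \<theta> * exp (- \<omega> \<theta> * t) * norm (x 0)"
    and v: "\<And>\<Theta>. \<Theta> \<noteq> {} \<Longrightarrow> compact \<Theta> \<Longrightarrow>
              \<exists>r>0. \<exists>K1 K2. 0 < K1 \<and> K1 < K2 \<and>
                (\<forall>x. \<forall>\<theta>\<in>\<Theta>. norm x \<le> r \<longrightarrow>
                   K1 * (norm x)\<^sup>2 \<le> V \<theta> x \<and> V \<theta> x \<le> Q \<theta> x \<and> Q \<theta> x \<le> K2 * (norm x)\<^sup>2)"
    and T: "T > 0"
    and a: "\<And>x. a x \<ge> 0" "continuous_on UNIV a" "positive_definite a"
           "\<exists>\<delta>>0. bdd_above {a x / (norm x)\<^sup>2 | x. x \<noteq> 0 \<and> norm x \<le> \<delta>}"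
    and N': "N' > N"
  shows "\<exists>Mt Rt :: real^'l \<Rightarrow> real^'l \<Rightarrow> real.
           (\<forall>\<theta> \<theta>h0. Mt \<theta> \<theta>h0 > 0 \<and> Rt \<theta> \<theta>h0 > 0) \<and>
           (\<forall>\<theta> x0 \<theta>h0. norm x0 \<le> Rt \<theta> \<theta>h0 \<longrightarrow>
              (\<exists>x u \<theta>h \<tau>. hybrid_solution f g k V Q a T N' \<theta> x0 \<theta>h0 x u \<theta>h \<tau>) \<and>
              (\<forall>x u \<theta>h \<tau>. hybrid_solution f g k V Q a T N' \<theta> x0 \<theta>h0 x u \<theta>h \<tau> \<longrightarrow>
                 filterlim \<tau> at_top sequentially \<and>
                 (\<forall>t\<ge>0. norm (x t) \<le> Mt \<theta> \<theta>h0 * exp (- \<omega> \<theta> * t) * norm x0)))"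
proof -
  have solutions: "\<exists>y. ode_solution (closed_loop_field f g k \<theta> \<theta>) {0..} y \<and> y 0 = x0" for \<theta> x0
    using i(1)[of \<theta>] by (simp add: globally_asymptotically_stable_def)
  have a_pos: "a x > 0" if "x \<noteq> 0" for x
    using a(3) that by (simp add: positive_definite_def)
  have below_threshold: "V \<eta> x < Q \<eta> x + a x" if "x \<noteq> 0" for \<eta> x
  proof -
    obtain y where "ode_solution (closed_loop_field f g k \<eta> \<eta>) {0..} y" "y 0 = x"
      using solutions by blast
    then show ?thesis
      using i(2)[of \<eta> y 0] a_pos[OF that] by simp
  qed
  interpret identifiable_loop f g k V Q a T N N'
  proof
    show "lipschitz_on_balls f" "lipschitz_on_balls g" "lipschitz_on_balls k"
      using f(1) g(1) k(1) by (simp_all add: smooth_imp_lipschitz_on_balls)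
  qed (fact f(2) g(2) k(2) V(1,2,4) T N' below_threshold solutions i(2) a_pos iii)+
  have "\<exists>Mt Rt. Mt > 0 \<and> Rt > 0 \<and> (\<forall>x0 x u \<theta>h \<tau>. norm x0 \<le> Rt \<longrightarrow>
      hybrid_solution f g k V Q a T N' \<theta> x0 \<theta>h0 x u \<theta>h \<tau> \<longrightarrow>
      (\<forall>t\<ge>0. norm (x t) \<le> Mt * exp (- \<omega> \<theta> * t) * norm x0))" for \<theta> \<theta>h0
    using exponential_stability[of "M \<theta>" "\<omega> \<theta>" "R \<theta>" \<theta> \<theta>h0] iv by blast
  then obtain Mt Rt where "\<And>\<theta> \<theta>h0. Mt \<theta> \<theta>h0 > 0 \<and> Rt \<theta> \<theta>h0 > 0 \<and>
      (\<forall>x0 x u \<theta>h \<tau>. norm x0 \<le> Rt \<theta> \<theta>h0 \<longrightarrow>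
      hybrid_solution f g k V Q a T N' \<theta> x0 \<theta>h0 x u \<theta>h \<tau> \<longrightarrow>
      (\<forall>t\<ge>0. norm (x t) \<le> Mt \<theta> \<theta>h0 * exp (- \<omega> \<theta> * t) * norm x0))"
    by metis
  then show ?thesis
    using hybrid_solution_exists[OF N'_pos] no_accumulation by (intro exI[of _ Mt] exI[of _ Rt]) blast
qed

end
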